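(* Let $$\bar V_n:=\sum_{k=0}^n\left(\frac{\langle\eta_k,(g_k\bar R_{k+1:n}1)^2\rangle}{\langle\eta_k,g_k\bar R_{k+1:n}1\rangle^2}-1\right)=\sum_{k=0}^n\Big(\frac1{p_k}-1\Big)+\sum_{k=0}^n\frac1{p_k}\,\frac{\mathrm{Var}(\bar R_{k+1:n}1,\bar\mu_k)}{\langle\bar\mu_k,\bar R_{k+1:n}1\rangle^2}$$ and $$V_n:=\sum_{k=0}^n\Big(\frac1{p_k}-1\Big)+\sum_{k=0}^n\frac1{p_k}\,\frac{\mathrm{Var}(R_{k+1:n}1,\mu_k)}{\langle\mu_k,R_{k+1:n}1\rangle^2}$$ be the asymptotic variances of the multilevel splitting particle approximations based on the Markov chains $(\mathcal{X}_k,\bar\pi_k)$ and $(\mathcal{X}_k,\bar\theta_k)$ respectively. Then $\bar V_n\le V_n$.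
   Context: Switching diffusion. $\mathbb{M}=\{1,\dots,m\}$ and $(X(t),\theta(t))_{t\ge0}$ is a strong Markov process on $\mathbb{R}^d\times\mathbb{M}$ with $dX(t)=b(X(t))1_{\theta(t)}dt+dW(t)$, $P[\theta(t+h)=j\mid X(t)=x,\theta(t)=i]=\delta_{ij}+\lambda_{ij}(x)h+o(h)$, $(X(0),\theta(0))\sim\eta$, where $W$ is a Wiener process on $\mathbb{R}^d$, $b:\mathbb{R}^d\to\mathbb{R}^{d\times m}$ is measurable, $\Lambda(x)=(\lambda_{ij}(x))$ is the rate matrix, $1_i$ is the $i$th unit vector of $\mathbb{R}^m$, and $\eta$ is a probability on $\mathbb{R}^d\times\mathbb{M}$. $\mathcal{P}(\mathbb{M})$ is the set of probability vectors on $\mathbb{M}$. Wonham filter. $\pi^i(t)=P(\theta(t)=i\mid\mathcal{F}^X(t))$ where $\mathcal{F}^X(t)=\sigma(X(u):0\le u\le t)$. The pair $(X(t),\pi(t))$ is a strong Markov diffusion given by $dX=b(X)\pi\,dt+d\tilde W$, $d\pi=\Lambda(X)^*\pi\,dt+(D(\pi)-\pi\pi^* )b(X)^*d\tilde W$, $\pi^i(0)=\frac{d\eta(\cdot,i)}{d\sum_{i'}\eta(\cdot,i')}(X(0))$, $X(0)\sim\sum_i\eta(\cdot,i)$, where $\tilde W$ is a Wiener process on $\mathbb{R}^d$ and $D(\pi)$ is the diagonal matrix with diagonal $\pi$. Splitting. $T>0$ is a fixed final time and $B=B_n\subset B_{n-1}\subset\cdots\subset B_0=\mathbb{R}^d$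 are subregions. $T_k:=\inf\{t\ge0:X(t)\in B_k\}$; these are non-decreasing $\mathcal{F}^X$-stopping times. $S_k:=T_k\wedge T$, with $S_0\equiv S_{-1}\equiv0$. $\mathcal{X}_k:[S_{k-1},S_k]\to\mathbb{R}^d$ is the random path segment $\mathcal{X}_k(t)=X(t)$, $S_{k-1}\le t\le S_k$, $k=0,1,\dots,n$. It takes values in $\mathcal{E}:=\{y^t_s\in C([s,t];\mathbb{R}^d):0\le s\le t\le T\}$, which is embedded injectively in $\mathbb{R}^2\times C([0,T];\mathbb{R}^d)$ by $y^t_s\mapsto(s,t,I_{[0,s)}(\cdot)y^t_s(s)+I_{[s,t]}(\cdot)y^t_s(\cdot)+I_{(t,T]}(\cdot)y^t_s(t))$ and carries the $\sigma$-algebra inherited from the Borel $\sigma$-algebra of that space. $\bar\theta_k:=\theta(S_k)$ and $\bar\pi_k:=\pi(S_k)$; the sequences $(\mathcal{X}_k,\bar\theta_k)$ and $(\mathcal{X}_k,\bar\pi_k)$ are Markov chains, with transition kernels $M_k$ and $\bar M_k$ respectively. Feynman–Kac distributions. For $e=y^t_s\in\mathcal{E}$ let $\varrho(e):=y^t_s(t)$ and $g_k(e):=I_{B_k}(\varrho(e))$, so that $I_{\{T_k\le T\}}=\prod_{p=0}^kg_p(\mathcal{X}_p)$; $g_k$ is also regarded as a function on $\mathcal{E}\times\mathbb{M}$ and on $\mathcal{E}\times\mathcal{P}(\mathbb{M})$ not depending on the second variable. For bounded measurable $\varphi$ on $\mathcal{E}\times\mathbb{M}$ and $F$ on $\mathcal{E}\times\mathcal{P}(\mathbb{M})$,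 $$\langle\gamma_k,\varphi\rangle:=E\Big[\varphi(\mathcal{X}_k,\bar\theta_k)\prod_{p=0}^kg_p(\mathcal{X}_p)\Big],\qquad\langle\Gamma_k,F\rangle:=E\Big[F(\mathcal{X}_k,\bar\pi_k)\prod_{p=0}^kg_p(\mathcal{X}_p)\Big],$$ $\mu_k:=\gamma_k/\langle\gamma_k,1\rangle$, $\bar\mu_k:=\Gamma_k/\langle\Gamma_k,1\rangle$. It is assumed that $P(T_n\le T)=\langle\gamma_n,1\rangle=\langle\Gamma_n,1\rangle>0$. Further, $$R_{k+1:n}1(e,i):=E\Big[\prod_{p=k+1}^ng_p(\mathcal{X}_p)\,\Big|\,\mathcal{X}_k=e,\bar\theta_k=i\Big],\qquad\bar R_{k+1:n}1(e,\pi):=E\Big[\prod_{p=k+1}^ng_p(\mathcal{X}_p)\,\Big|\,\mathcal{X}_k=e,\bar\pi_k=\pi\Big],$$ with $R_{n+1:n}1=\bar R_{n+1:n}1=1$. $\eta_0$ is the distribution of $(X(0),\pi(0))$ (equivalently of $(\mathcal{X}_0,\bar\pi_0)$), $\eta_k:=\bar\mu_{k-1}\bar M_k$ for $k=1,\dots,n$, and $p_k:=\langle\eta_k,g_k\rangle$ for $k=0,\dots,n$, so that $p_k=P(T_k\le T\mid T_{k-1}\le T)$ for $k\ge1$. $\mathrm{Var}(h,\mu):=\langle\mu,h^2\rangle-\langle\mu,h\rangle^2$ is the variance of $h$ under the probability $\mu$. *)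

theory Defs
  imports "HOL-Probability.Probability" "HOL-Library.Landau_Symbols"
begin

section \<open>Filtrations and strong Markov processes\<close>

definition gen_algebra :: "'w measure \<Rightarrow> 'a measure \<Rightarrow> ('i \<Rightarrow> 'w \<Rightarrow> 'a) \<Rightarrow> 'i set \<Rightarrow> 'w measure" where
  "gen_algebra M N Y I = sigma (space M) {Y u -` A \<inter> space M | u A. u \<in> I \<and> A \<in> sets N}"

text \<open>Time is indexed by \<^typ>\<open>ennreal\<close> here because the hitting times below may be infinite and
  the library's stopping times take their values in the index type of the filtration.\<close>

definition nat_filtration :: "'w measure \<Rightarrow> 'a measure \<Rightarrow> (real \<Rightarrow> 'w \<Rightarrow> 'a) \<Rightarrow> ennreal \<Rightarrow> 'w measure" where
  "nat_filtration M N Y t = gen_algebra M N Y {u. 0 \<le> u \<and> ennreal u \<le> t}"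

definition transition_function :: "'a measure \<Rightarrow> (real \<Rightarrow> 'a \<Rightarrow> 'a measure) \<Rightarrow> bool" where
  "transition_function N P \<longleftrightarrow>
     (\<forall>t\<ge>0. P t \<in> N \<rightarrow>\<^sub>M prob_algebra N) \<and>
     (\<forall>z\<in>space N. P 0 z = return N z) \<and>
     (\<forall>s\<ge>0. \<forall>t\<ge>0. \<forall>z\<in>space N. P (s + t) z = P s z \<bind> P t)"

definition strong_markov ::
    "'w measure \<Rightarrow> 'a measure \<Rightarrow> (real \<Rightarrow> 'w \<Rightarrow> 'a) \<Rightarrow> (real \<Rightarrow> 'a \<Rightarrow> 'a measure) \<Rightarrow> bool" where
  "strong_markov M N Y P \<longleftrightarrow>
     transition_function N P \<and>
     (\<forall>t\<ge>0. Y t \<in> M \<rightarrow>\<^sub>M N) \<and>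
     (\<forall>\<tau> h A. stopping_time (nat_filtration M N Y) \<tau> \<longrightarrow> 0 \<le> h \<longrightarrow> A \<in> sets N \<longrightarrow>
        (AE \<omega> in M. \<tau> \<omega> < \<infinity> \<longrightarrow>
           real_cond_exp M (filtration.pre_sigma (space M) (nat_filtration M N Y) \<tau>)
             (indicator {\<omega>'. \<tau> \<omega>' < \<infinity> \<and> Y (enn2real (\<tau> \<omega>') + h) \<omega>' \<in> A}) \<omega>
           = measure (P h (Y (enn2real (\<tau> \<omega>)) \<omega>)) A))"

section \<open>Wiener processes and the Ito integral\<close>

definition wiener_process ::
    "'w measure \<Rightarrow> (real \<Rightarrow> 'w measure) \<Rightarrow> (real \<Rightarrow> 'w \<Rightarrow> real^'d) \<Rightarrow> bool" where
  "wiener_process M F W \<longleftrightarrow>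
     (\<forall>t\<ge>0. subalgebra M (F t)) \<and>
     (\<forall>s\<ge>0. \<forall>t\<ge>s. sets (F s) \<subseteq> sets (F t)) \<and>
     (\<forall>t\<ge>0. W t \<in> borel_measurable (F t)) \<and>
     (AE \<omega> in M. W 0 \<omega> = 0) \<and>
     (AE \<omega> in M. continuous_on {0..} (\<lambda>t. W t \<omega>)) \<and>
     (\<forall>s\<ge>0. \<forall>t>s.
        distributed M lborel (\<lambda>\<omega>. W t \<omega> - W s \<omega>)
          (\<lambda>x. ennreal (\<Prod>i\<in>UNIV. normal_density 0 (sqrt (t - s)) (x $ i))) \<and>
        prob_space.indep_set M (sets (F s))
          (sets (vimage_algebra (space M) (\<lambda>\<omega>. W t \<omega> - W s \<omega>) borel)))"

text \<open>A simple process is $\sum_{j<N} 1_{(t_j,t_{j+1}]}\,\xi_j$ with $\xi_j$ bounded and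
  measurable with respect to the information at time $t_j$; it takes matrix values, so that its
  integral against a $d$-dimensional Wiener process is a vector.\<close>

definition simple_process ::
    "'w measure \<Rightarrow> (real \<Rightarrow> 'w measure) \<Rightarrow> nat \<Rightarrow> (nat \<Rightarrow> real) \<Rightarrow> (nat \<Rightarrow> 'w \<Rightarrow> real^'d^'m) \<Rightarrow> bool" where
  "simple_process M F N t \<xi> \<longleftrightarrow>
     0 \<le> t 0 \<and> (\<forall>j<N. t j \<le> t (Suc j)) \<and>
     (\<forall>j<N. \<xi> j \<in> borel_measurable (F (t j)) \<and> (\<exists>C. \<forall>\<omega>\<in>space M. norm (\<xi> j \<omega>) \<le> C))"

definition simple_value ::
    "nat \<Rightarrow> (nat \<Rightarrow> real) \<Rightarrow> (nat \<Rightarrow> 'w \<Rightarrow> real^'d^'m) \<Rightarrow> real \<Rightarrow> 'w \<Rightarrow> real^'d^'m" where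
  "simple_value N t \<xi> s \<omega> = (\<Sum>j<N. indicator {t j<..t (Suc j)} s *\<^sub>R \<xi> j \<omega>)"

definition simple_integral_wrt ::
    "(real \<Rightarrow> 'w \<Rightarrow> real^'d) \<Rightarrow> nat \<Rightarrow> (nat \<Rightarrow> real) \<Rightarrow> (nat \<Rightarrow> 'w \<Rightarrow> real^'d^'m) \<Rightarrow> real \<Rightarrow> 'w \<Rightarrow> real^'m" where
  "simple_integral_wrt W N t \<xi> s \<omega> =
     (\<Sum>j<N. \<xi> j \<omega> *v (W (min (t (Suc j)) s) \<omega> - W (min (t j) s) \<omega>))"

text \<open>\<open>ito_integral M F W H I\<close> states that $I(t)=\int_0^t H\,dW$ for all $t\ge 0$: the
  integrand is progressively measurable, and there are simple processes $H^l$ with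
  $\int_0^t\|H^l-H\|^2ds\to0$ and $\int_0^t H^l dW\to I(t)$ in probability. Such $H^l$ exist exactly
  when $\int_0^t\|H\|^2ds<\infty$ almost surely for all $t$, and $I$ is then unique up to
  indistinguishability.\<close>

definition ito_integral ::
    "'w measure \<Rightarrow> (real \<Rightarrow> 'w measure) \<Rightarrow> (real \<Rightarrow> 'w \<Rightarrow> real^'d) \<Rightarrow>
     (real \<Rightarrow> 'w \<Rightarrow> real^'d^'m) \<Rightarrow> (real \<Rightarrow> 'w \<Rightarrow> real^'m) \<Rightarrow> bool" where
  "ito_integral M F W H I \<longleftrightarrow>
     (\<forall>t\<ge>0. (\<lambda>(s, \<omega>). H s \<omega>) \<in> borel_measurable (restrict_space borel {0..t} \<Otimes>\<^sub>M F t)) \<and>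
     (AE \<omega> in M. continuous_on {0..} (\<lambda>t. I t \<omega>)) \<and>
     (\<exists>N \<tau> \<xi>. (\<forall>l::nat. simple_process M F (N l) (\<tau> l) (\<xi> l)) \<and>
        (\<forall>t\<ge>0. \<forall>\<epsilon>>0.
           (\<lambda>l. measure M {\<omega>\<in>space M. ennreal \<epsilon> <
              (\<integral>\<^sup>+s\<in>{0..t}. ennreal ((norm (simple_value (N l) (\<tau> l) (\<xi> l) s \<omega> - H s \<omega>))\<^sup>2) \<partial>lborel)})
             \<longlonglongrightarrow> 0 \<and>
           (\<lambda>l. measure M {\<omega>\<in>space M.
              \<epsilon> < norm (simple_integral_wrt W (N l) (\<tau> l) (\<xi> l) t \<omega> - I t \<omega>)}) \<longlonglongrightarrow> 0))"

section \<open>The switching diffusion and the Wonham filter\<close>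

text \<open>The set $\{1,\dots,m\}$ is a finite type \<open>'m\<close>, and $b(x)$ is the $d\times m$ matrix whose
  $i$th column is the drift in mode $i$.\<close>

definition rate_matrix :: "real^'m^'m \<Rightarrow> bool" where
  "rate_matrix L \<longleftrightarrow> (\<forall>i j. i \<noteq> j \<longrightarrow> 0 \<le> L $ i $ j) \<and> (\<forall>i. (\<Sum>j\<in>UNIV. L $ i $ j) = 0)"

abbreviation mode_space :: "((real^'d) \<times> 'm) measure" where
  "mode_space \<equiv> borel \<Otimes>\<^sub>M count_space UNIV"

text \<open>The filtration \<open>G\<close> is the one for which \<open>W\<close> is a Wiener process in the stochastic
  equation. The conditional probabilities defining the jump rates are given by the transition
  function \<open>P\<close> of the process.\<close>

definition switching_diffusion ::
    "'w measure \<Rightarrow> (real \<Rightarrow> 'w measure) \<Rightarrow> (real \<Rightarrow> 'w \<Rightarrow> real^'d) \<Rightarrow>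
     (real \<Rightarrow> (real^'d) \<times> 'm \<Rightarrow> ((real^'d) \<times> 'm) measure) \<Rightarrow>
     (real^'d \<Rightarrow> real^'m^'d) \<Rightarrow> (real^'d \<Rightarrow> real^'m^'m) \<Rightarrow> ((real^'d) \<times> 'm) measure \<Rightarrow>
     (real \<Rightarrow> 'w \<Rightarrow> real^'d) \<Rightarrow> (real \<Rightarrow> 'w \<Rightarrow> 'm) \<Rightarrow> bool" where
  "switching_diffusion M G W P b \<Lambda> \<eta> X \<theta> \<longleftrightarrow>
     b \<in> borel_measurable borel \<and>
     (\<forall>x. rate_matrix (\<Lambda> x)) \<and>
     \<eta> \<in> space (prob_algebra mode_space) \<and>
     wiener_process M G W \<and>
     (\<forall>t\<ge>0. X t \<in> borel_measurable (G t) \<and> \<theta> t \<in> G t \<rightarrow>\<^sub>M count_space UNIV) \<and>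
     (\<forall>\<omega>\<in>space M. continuous_on {0..} (\<lambda>t. X t \<omega>)) \<and>
     (\<forall>\<omega>\<in>space M.
        (\<forall>t\<ge>0. \<forall>\<^sub>F s in at_right t. \<theta> s \<omega> = \<theta> t \<omega>) \<and>
        (\<forall>t>0. \<exists>i. \<forall>\<^sub>F s in at_left t. \<theta> s \<omega> = i)) \<and>
     strong_markov M mode_space (\<lambda>t \<omega>. (X t \<omega>, \<theta> t \<omega>)) P \<and>
     (AE \<omega> in M. \<forall>t\<ge>0.
        set_integrable lborel {0..t} (\<lambda>s. b (X s \<omega>) *v axis (\<theta> s \<omega>) 1) \<and>
        X t \<omega> = X 0 \<omega> + (LINT s:{0..t}|lborel. b (X s \<omega>) *v axis (\<theta> s \<omega>) 1) + W t \<omega>) \<and>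
     (\<forall>x i j. (\<lambda>h. measure (P h (x, i)) (UNIV \<times> {j}) - (if i = j then 1 else 0) - \<Lambda> x $ i $ j * h)
        \<in> o[at_right 0](\<lambda>h. h)) \<and>
     distr M mode_space (\<lambda>\<omega>. (X 0 \<omega>, \<theta> 0 \<omega>)) = \<eta>"

definition prob_vectors :: "(real^'m) set" where
  "prob_vectors = {p. (\<forall>i. 0 \<le> p $ i) \<and> (\<Sum>i\<in>UNIV. p $ i) = 1}"

abbreviation prob_vector_space :: "(real^'m) measure" where
  "prob_vector_space \<equiv> restrict_space borel prob_vectors"

text \<open>For each $t$ the vector $\pi(t)$ is a version of the conditional law of $\theta(t)$; the
  versions are chosen so that the paths are continuous and stay in the set of probability vectors.\<close>

definition wonham_filter ::
    "'w measure \<Rightarrow> (real \<Rightarrow> 'w \<Rightarrow> real^'d) \<Rightarrow> (real \<Rightarrow> 'w \<Rightarrow> 'm) \<Rightarrow> (real \<Rightarrow> 'w \<Rightarrow> real^'m) \<Rightarrow> bool" where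
  "wonham_filter M X \<theta> \<pi> \<longleftrightarrow>
     (\<forall>t\<ge>0. \<pi> t \<in> M \<rightarrow>\<^sub>M prob_vector_space) \<and>
     (\<forall>\<omega>\<in>space M. continuous_on {0..} (\<lambda>t. \<pi> t \<omega>)) \<and>
     (\<forall>t\<ge>0. \<forall>i. AE \<omega> in M.
        \<pi> t \<omega> $ i = real_cond_exp M (nat_filtration M borel X (ennreal t)) (indicator {\<omega>'. \<theta> t \<omega>' = i}) \<omega>)"

definition diag_mat :: "real^'m \<Rightarrow> real^'m^'m" where
  "diag_mat p = (\<chi> i j. if i = j then p $ i else 0)"

definition outer_mat :: "real^'m \<Rightarrow> real^'m^'m" where
  "outer_mat p = (\<chi> i j. p $ i * p $ j)"

text \<open>The pair $(X,\pi)$ as a diffusion driven by the Wiener process \<open>W\<close> (which is not the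
  one driving the switching diffusion). The equation for $\pi$ is written by saying that the
  increment of $\pi$ minus the drift term is the stochastic integral; the initial value is the
  Radon-Nikodym derivative of the $i$th component of $\eta$ with respect to the first marginal.\<close>

definition wonham_diffusion ::
    "'w measure \<Rightarrow> (real \<Rightarrow> 'w measure) \<Rightarrow> (real \<Rightarrow> 'w \<Rightarrow> real^'d) \<Rightarrow>
     (real \<Rightarrow> (real^'d) \<times> (real^'m) \<Rightarrow> ((real^'d) \<times> (real^'m)) measure) \<Rightarrow>
     (real^'d \<Rightarrow> real^'m^'d) \<Rightarrow> (real^'d \<Rightarrow> real^'m^'m) \<Rightarrow> ((real^'d) \<times> 'm) measure \<Rightarrow>
     (real \<Rightarrow> 'w \<Rightarrow> real^'d) \<Rightarrow> (real \<Rightarrow> 'w \<Rightarrow> real^'m) \<Rightarrow> bool" where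
  "wonham_diffusion M G W Q b \<Lambda> \<eta> X \<pi> \<longleftrightarrow>
     wiener_process M G W \<and>
     (\<forall>t\<ge>0. X t \<in> borel_measurable (G t) \<and> \<pi> t \<in> borel_measurable (G t)) \<and>
     strong_markov M (borel \<Otimes>\<^sub>M prob_vector_space) (\<lambda>t \<omega>. (X t \<omega>, \<pi> t \<omega>)) Q \<and>
     (AE \<omega> in M. \<forall>t\<ge>0.
        set_integrable lborel {0..t} (\<lambda>s. b (X s \<omega>) *v \<pi> s \<omega>) \<and>
        X t \<omega> = X 0 \<omega> + (LINT s:{0..t}|lborel. b (X s \<omega>) *v \<pi> s \<omega>) + W t \<omega>) \<and>
     (AE \<omega> in M. \<forall>t\<ge>0.
        set_integrable lborel {0..t} (\<lambda>s. transpose (\<Lambda> (X s \<omega>)) *v \<pi> s \<omega>)) \<and>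
     ito_integral M G W
       (\<lambda>s \<omega>. (diag_mat (\<pi> s \<omega>) - outer_mat (\<pi> s \<omega>)) ** transpose (b (X s \<omega>)))
       (\<lambda>t \<omega>. \<pi> t \<omega> - \<pi> 0 \<omega> - (LINT s:{0..t}|lborel. transpose (\<Lambda> (X s \<omega>)) *v \<pi> s \<omega>)) \<and>
     distr M borel (X 0) = distr \<eta> borel fst \<and>
     (\<forall>i. AE \<omega> in M. \<pi> 0 \<omega> $ i =
        enn2real (RN_deriv (distr \<eta> borel fst)
          (distr (density \<eta> (indicator (UNIV \<times> {i}))) borel fst) (X 0 \<omega>)))"

section \<open>Path segments and levels\<close>

text \<open>A path segment $y$ on $[s,t]$ is the triple of $s$, $t$ and the extension of $y$ that is
  constant on either side of $[s,t]$. The extension is taken on the whole line rather than on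
  $[0,T]$: the bounded continuous functions that are constant on either side of $[0,T]$ form an
  isometric copy of $C([0,T])$ with the supremum norm, so that the Borel sets inherited by the
  image of the embedding are the same.\<close>

type_synonym 'd segment = "real \<times> real \<times> (real \<Rightarrow>\<^sub>C (real^'d))"

definition embed_segment :: "real \<Rightarrow> real \<Rightarrow> (real \<Rightarrow> real^'d) \<Rightarrow> 'd segment" where
  "embed_segment s t y = (s, t, Bcontfun (\<lambda>u. y (max s (min t u))))"

definition segments :: "real \<Rightarrow> ('d::finite) segment set" where
  "segments T = {embed_segment s t y | s t y. 0 \<le> s \<and> s \<le> t \<and> t \<le> T \<and> continuous_on {s..t} y}"

abbreviation segment_space :: "real \<Rightarrow> ('d::finite) segment measure" where
  "segment_space T \<equiv> restrict_space borel (segments T)"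

definition end_value :: "('d::finite) segment \<Rightarrow> real^'d" where
  "end_value e = apply_bcontfun (snd (snd e)) (fst (snd e))"

definition hitting_time :: "(real \<Rightarrow> 'w \<Rightarrow> real^'d) \<Rightarrow> (real^'d) set \<Rightarrow> 'w \<Rightarrow> ennreal" where
  "hitting_time X A \<omega> = (INF t\<in>{t. 0 \<le> t \<and> X t \<omega> \<in> A}. ennreal t)"

definition level_time ::
    "real \<Rightarrow> (real \<Rightarrow> 'w \<Rightarrow> real^'d) \<Rightarrow> (nat \<Rightarrow> (real^'d) set) \<Rightarrow> nat \<Rightarrow> 'w \<Rightarrow> real" where
  "level_time T X B k \<omega> = enn2real (min (hitting_time X (B k) \<omega>) (ennreal T))"

definition level_segment ::
    "real \<Rightarrow> (real \<Rightarrow> 'w \<Rightarrow> real^'d) \<Rightarrow> (nat \<Rightarrow> (real^'d) set) \<Rightarrow> nat \<Rightarrow> 'w \<Rightarrow> 'd segment" where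
  "level_segment T X B k \<omega> =
     embed_segment (if k = 0 then 0 else level_time T X B (k - 1) \<omega>) (level_time T X B k \<omega>)
       (\<lambda>t. X t \<omega>)"

definition level_chain ::
    "real \<Rightarrow> (real \<Rightarrow> 'w \<Rightarrow> real^'d) \<Rightarrow> (nat \<Rightarrow> (real^'d) set) \<Rightarrow> (real \<Rightarrow> 'w \<Rightarrow> 'c) \<Rightarrow>
     nat \<Rightarrow> 'w \<Rightarrow> 'd segment \<times> 'c" where
  "level_chain T X B Y k \<omega> = (level_segment T X B k \<omega>, Y (level_time T X B k \<omega>) \<omega>)"

abbreviation segment_mode_space :: "real \<Rightarrow> ('d::finite segment \<times> 'm) measure" where
  "segment_mode_space T \<equiv> segment_space T \<Otimes>\<^sub>M count_space UNIV"

abbreviation segment_filter_space :: "real \<Rightarrow> ('d::finite segment \<times> (real^'m)) measure" where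
  "segment_filter_space T \<equiv> segment_space T \<Otimes>\<^sub>M prob_vector_space"

text \<open>\<open>K k\<close> is the transition kernel from step $k-1$ to step $k$.\<close>

definition markov_chain ::
    "'w measure \<Rightarrow> 'a measure \<Rightarrow> nat \<Rightarrow> (nat \<Rightarrow> 'w \<Rightarrow> 'a) \<Rightarrow> (nat \<Rightarrow> 'a \<Rightarrow> 'a measure) \<Rightarrow> bool" where
  "markov_chain M N n Z K \<longleftrightarrow>
     (\<forall>k\<le>n. Z k \<in> M \<rightarrow>\<^sub>M N) \<and>
     (\<forall>k\<in>{1..n}. K k \<in> N \<rightarrow>\<^sub>M prob_algebra N) \<and>
     (\<forall>k\<in>{1..n}. \<forall>A\<in>sets N. AE \<omega> in M.
        real_cond_exp M (gen_algebra M N Z {..<k}) (indicator {\<omega>'. Z k \<omega>' \<in> A}) \<omega>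
        = measure (K k (Z (k - 1) \<omega>)) A)"

section \<open>Feynman-Kac distributions\<close>

definition potential :: "(nat \<Rightarrow> (real^'d) set) \<Rightarrow> nat \<Rightarrow> ('d::finite) segment \<times> 'c \<Rightarrow> real" where
  "potential B k z = indicator (B k) (end_value (fst z))"

definition feynman_kac ::
    "'w measure \<Rightarrow> 'a measure \<Rightarrow> (nat \<Rightarrow> 'a \<Rightarrow> real) \<Rightarrow> (nat \<Rightarrow> 'w \<Rightarrow> 'a) \<Rightarrow> nat \<Rightarrow> 'a measure" where
  "feynman_kac M N g Z k = distr (density M (\<lambda>\<omega>. ennreal (\<Prod>p\<le>k. g p (Z p \<omega>)))) N (Z k)"

lemma integral_feynman_kac:
  fixes \<phi> :: "'a \<Rightarrow> real"
  assumes Z: "\<And>p. p \<le> k \<Longrightarrow> Z p \<in> M \<rightarrow>\<^sub>M N"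
    and g: "\<And>p. p \<le> k \<Longrightarrow> g p \<in> borel_measurable N" "\<And>p z. 0 \<le> g p z"
    and \<phi>: "\<phi> \<in> borel_measurable N"
  shows "(\<integral>z. \<phi> z \<partial>feynman_kac M N g Z k) = (\<integral>\<omega>. \<phi> (Z k \<omega>) * (\<Prod>p\<le>k. g p (Z p \<omega>)) \<partial>M)"
proof -
  let ?w = "\<lambda>\<omega>. \<Prod>p\<le>k. g p (Z p \<omega>)"
  have w: "?w \<in> borel_measurable M"
    by (rule borel_measurable_prod, rule measurable_compose[OF Z g(1)], simp_all)
  have Zk: "Z k \<in> density M (\<lambda>\<omega>. ennreal (?w \<omega>)) \<rightarrow>\<^sub>M N"
    using Z[of k] by simp
  have "(\<integral>z. \<phi> z \<partial>feynman_kac M N g Z k) = (\<integral>\<omega>. \<phi> (Z k \<omega>) \<partial>density M (\<lambda>\<omega>. ennreal (?w \<omega>)))"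
    unfolding feynman_kac_def by (rule integral_distr[OF Zk \<phi>])
  also have "\<dots> = (\<integral>\<omega>. ?w \<omega> *\<^sub>R \<phi> (Z k \<omega>) \<partial>M)"
    by (rule integral_density[OF measurable_compose[OF Z \<phi>] w]) (simp_all add: prod_nonneg g(2))
  finally show ?thesis
    by (simp add: mult.commute)
qed

definition normalized :: "'a measure \<Rightarrow> 'a measure" where
  "normalized \<mu> = scale_measure (1 / emeasure \<mu> (space \<mu>)) \<mu>"

definition predicted ::
    "'w measure \<Rightarrow> 'a measure \<Rightarrow> (nat \<Rightarrow> 'a \<Rightarrow> real) \<Rightarrow> (nat \<Rightarrow> 'w \<Rightarrow> 'a) \<Rightarrow> (nat \<Rightarrow> 'a \<Rightarrow> 'a measure) \<Rightarrow>
     nat \<Rightarrow> 'a measure" where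
  "predicted M N g Z K k =
     (if k = 0 then distr M N (Z 0) else normalized (feynman_kac M N g Z (k - 1)) \<bind> K k)"

text \<open>\<open>cond_exp_given M N Z Y r\<close> states that $r(z)=E[Y\mid Z=z]$.\<close>

definition cond_exp_given ::
    "'w measure \<Rightarrow> 'a measure \<Rightarrow> ('w \<Rightarrow> 'a) \<Rightarrow> ('w \<Rightarrow> real) \<Rightarrow> ('a \<Rightarrow> real) \<Rightarrow> bool" where
  "cond_exp_given M N Z Y r \<longleftrightarrow>
     r \<in> borel_measurable N \<and>
     (AE \<omega> in M. real_cond_exp M (vimage_algebra (space M) Z N) Y \<omega> = r (Z \<omega>))"

text \<open>\<open>R k\<close> stands for $R_{k+1:n}1$.\<close>

definition survival_functions ::
    "'w measure \<Rightarrow> 'a measure \<Rightarrow> nat \<Rightarrow> (nat \<Rightarrow> 'a \<Rightarrow> real) \<Rightarrow> (nat \<Rightarrow> 'w \<Rightarrow> 'a) \<Rightarrow> (nat \<Rightarrow> 'a \<Rightarrow> real) \<Rightarrow> bool" where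
  "survival_functions M N n g Z R \<longleftrightarrow>
     (\<forall>k<n. cond_exp_given M N (Z k) (\<lambda>\<omega>. \<Prod>p\<in>{k+1..n}. g p (Z p \<omega>)) (R k)) \<and>
     (\<forall>z\<in>space N. R n z = 1)"

definition Var :: "('a \<Rightarrow> real) \<Rightarrow> 'a measure \<Rightarrow> real" where
  "Var h \<mu> = (\<integral>z. (h z)\<^sup>2 \<partial>\<mu>) - (\<integral>z. h z \<partial>\<mu>)\<^sup>2"

definition variance_formula ::
    "nat \<Rightarrow> (nat \<Rightarrow> real) \<Rightarrow> (nat \<Rightarrow> 'a measure) \<Rightarrow> (nat \<Rightarrow> 'a \<Rightarrow> real) \<Rightarrow> real" where
  "variance_formula n p \<mu> R =
     (\<Sum>k\<le>n. 1 / p k - 1) +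
     (\<Sum>k\<le>n. 1 / p k * (Var (R k) (\<mu> k) / (\<integral>z. R k z \<partial>\<mu> k)\<^sup>2))"

end

theory Submission
  imports Defs
begin

text \<open>Both variance formulas become comparable once every integral is written on the probability space
  that carries the processes. Put $w_k=\prod_{p<k}g_p(Z_p)$ for a chain $Z$ with survival functions
  $R_k$. The updated distribution is the law of $Z_k$ reweighted by $w_{k+1}/E[w_{k+1}]$. The
  predicted distribution is the law of $Z_k$ reweighted by $w_k/E[w_k]$, because applying the kernel
  to a reweighted law of $Z_{k-1}$ gives the law of $Z_k$ with the same weight, by the Markov
  property (\<open>one_step\<close>). Since the potentials are indicators and $E[R_k(Z_k)w_{k+1}]$ is the probability of
  reaching the last level, both expressions for the variance reduce to the same sum
  \[\sum_k\Big(\frac{E[R_k(Z_k)^2w_{k+1}]\,E[w_k]}{E[w_{n+1}]^2}-1\Big)\]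
  (\<open>variance_formula_moments\<close>, \<open>predicted_survival\<close>). The weights depend on the path segments only, so
  they agree for the two chains, and it remains to compare the second moments.

  By the Markov property, $R_k(Z_k)$ is the conditional expectation of $G=\prod_{p>k}g_p$ not only
  given $Z_k$ but given the whole past $(Z_0,\dots,Z_k)$ (\<open>bounded_survival\<close>). Let $\mathcal{H}$
  be the past of the chain with the modes and $\mathcal{H}'$ that of the chain with the filter. Up to null
  sets $\mathcal{H}'\subseteq\mathcal{H}$: the filter at a level time is a function of the path up to that
  time (\<open>filter_at_stop\<close>), and this path is pieced together from the segments seen so far
  (\<open>stopped_path_measurable\<close>). Hence $E[G|\mathcal{H}']$ is the projection of $E[G|\mathcal{H}]$ on
  a smaller $\sigma$-algebra, and conditional expectation decreases second moments, also with the
  $\mathcal{H}'$-measurable weight $w_{k+1}$ (\<open>second_moment_le\<close>).\<close>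

section \<open>Generated $\sigma$-algebras\<close>

lemma space_gen_algebra [simp]: "space (gen_algebra M N Y I) = space M"
  unfolding gen_algebra_def by (rule space_measure_of) auto

lemma sets_gen_algebra:
  "sets (gen_algebra M N Y I) = sigma_sets (space M) {Y u -` A \<inter> space M | u A. u \<in> I \<and> A \<in> sets N}"
  unfolding gen_algebra_def by (rule sets_measure_of) auto

lemma subalgebra_gen_algebra:
  assumes "\<And>i. i \<in> I \<Longrightarrow> Y i \<in> M \<rightarrow>\<^sub>M N"
  shows "subalgebra M (gen_algebra M N Y I)"
proof -
  have "sigma_sets (space M) {Y u -` A \<inter> space M | u A. u \<in> I \<and> A \<in> sets N} \<subseteq> sets M"
    by (rule sets.sigma_sets_subset) (use measurable_sets[OF assms] in auto)
  then show ?thesis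
    by (simp add: subalgebra_def sets_gen_algebra)
qed

lemma measurable_gen_algebra:
  assumes "i \<in> I" "Y i \<in> space M \<rightarrow> space N"
  shows "Y i \<in> gen_algebra M N Y I \<rightarrow>\<^sub>M N"
proof (rule measurableI)
  fix A assume "A \<in> sets N"
  then show "Y i -` A \<inter> space (gen_algebra M N Y I) \<in> sets (gen_algebra M N Y I)"
    using assms(1) by (auto simp: sets_gen_algebra intro!: sigma_sets.Basic)
qed (use assms in auto)

lemma subalgebra_gen_algebra_mono:
  assumes "I \<subseteq> J"
  shows "subalgebra (gen_algebra M N Y J) (gen_algebra M N Y I)"
proof -
  have "sigma_sets (space M) {Y u -` A \<inter> space M | u A. u \<in> I \<and> A \<in> sets N}
      \<subseteq> sigma_sets (space M) {Y u -` A \<inter> space M | u A. u \<in> J \<and> A \<in> sets N}"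
    by (rule sigma_sets_mono') (use assms in auto)
  then show ?thesis
    by (simp add: subalgebra_def sets_gen_algebra)
qed

text \<open>The test functions of the conditional expectations below. Values in $[0,1]$ make every integral
  finite, and indicators of events belong to the class.\<close>

definition unit_measurable :: "'b measure \<Rightarrow> ('b \<Rightarrow> real) set" where
  "unit_measurable L = {f \<in> borel_measurable L. \<forall>x\<in>space L. 0 \<le> f x \<and> f x \<le> 1}"

lemma unit_measurableI:
  "f \<in> borel_measurable L \<Longrightarrow> (\<And>x. x \<in> space L \<Longrightarrow> 0 \<le> f x \<and> f x \<le> 1) \<Longrightarrow> f \<in> unit_measurable L"
  by (simp add: unit_measurable_def)

lemma unit_measurableD:
  assumes "f \<in> unit_measurable L"
  shows "f \<in> borel_measurable L" "\<And>x. x \<in> space L \<Longrightarrow> 0 \<le> f x \<and> f x \<le> 1"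
  using assms by (auto simp: unit_measurable_def)

section \<open>Feynman-Kac models with indicator potentials\<close>

locale feynman_kac_chain = prob_space M for M :: "'w measure" +
  fixes N :: "'a measure" and n :: nat and Z :: "nat \<Rightarrow> 'w \<Rightarrow> 'a"
    and K :: "nat \<Rightarrow> 'a \<Rightarrow> 'a measure" and g R :: "nat \<Rightarrow> 'a \<Rightarrow> real"
  assumes chain: "markov_chain M N n Z K"
    and g_measurable: "p \<le> n \<Longrightarrow> g p \<in> borel_measurable N"
    and g_binary: "g p z \<in> {0, 1}"
    and survival: "survival_functions M N n g Z R"
    and survivors: "0 < (\<integral>\<omega>. (\<Prod>p\<le>n. g p (Z p \<omega>)) \<partial>M)"
begin

lemma g_bounds [simp]: "0 \<le> g p z" "g p z \<le> 1"
  using g_binary[of p z] by auto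

lemma Z_measurable: "k \<le> n \<Longrightarrow> Z k \<in> M \<rightarrow>\<^sub>M N"
  using chain by (auto simp: markov_chain_def)

lemma K_measurable: "k \<in> {1..n} \<Longrightarrow> K k \<in> N \<rightarrow>\<^sub>M prob_algebra N"
  using chain by (auto simp: markov_chain_def)

text \<open>The past strictly before step \<open>k\<close>; likewise \<open>weight k\<close> omits the potential at \<open>k\<close>. Predicted
  distributions thus carry the weight with index \<open>k\<close>, updated ones that with index \<open>Suc k\<close>.\<close>

definition history :: "nat \<Rightarrow> 'w measure" where
  "history k = gen_algebra M N Z {..<k}"

definition weight :: "nat \<Rightarrow> 'w \<Rightarrow> real" where
  "weight k \<omega> = (\<Prod>p<k. g p (Z p \<omega>))"

definition mass :: "nat \<Rightarrow> real" where
  "mass k = (\<integral>\<omega>. weight k \<omega> \<partial>M)"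

lemma space_history [simp]: "space (history k) = space M"
  by (simp add: history_def)

lemma subalgebra_history: "k \<le> Suc n \<Longrightarrow> subalgebra M (history k)"
  unfolding history_def by (rule subalgebra_gen_algebra) (auto intro: Z_measurable)

lemma history_measurable: "f \<in> history k \<rightarrow>\<^sub>M L \<Longrightarrow> k \<le> Suc n \<Longrightarrow> f \<in> M \<rightarrow>\<^sub>M L"
  using measurable_from_subalg[OF subalgebra_history] by blast

lemma history_mono: "f \<in> history j \<rightarrow>\<^sub>M L \<Longrightarrow> j \<le> k \<Longrightarrow> f \<in> history k \<rightarrow>\<^sub>M L"
  unfolding history_def
  by (rule measurable_from_subalg[OF subalgebra_gen_algebra_mono]) auto

lemma Z_history: "j < k \<Longrightarrow> j \<le> n \<Longrightarrow> Z j \<in> history k \<rightarrow>\<^sub>M N"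
  unfolding history_def
  by (rule measurable_gen_algebra) (use measurable_space[OF Z_measurable] in auto)

lemma weight_history: "k \<le> Suc n \<Longrightarrow> weight k \<in> borel_measurable (history k)"
  unfolding weight_def
  by (rule borel_measurable_prod, rule measurable_compose[OF Z_history g_measurable]) auto

lemma weight_measurable: "k \<le> Suc n \<Longrightarrow> weight k \<in> borel_measurable M"
  using history_measurable weight_history by blast

lemma weight_bounds [simp]: "0 \<le> weight k \<omega>" "weight k \<omega> \<le> 1"
  by (auto simp: weight_def intro: prod_nonneg prod_le_1)

lemma weight_Suc: "weight (Suc k) \<omega> = weight k \<omega> * g k (Z k \<omega>)"
  by (simp add: weight_def)

lemma bounded_integrable:
  assumes "f \<in> borel_measurable M" "AE \<omega> in M. \<bar>f \<omega>\<bar> \<le> (C::real)"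
  shows "integrable M f"
  using assms by (intro integrable_const_bound[of _ C]) auto

lemma integrable_weight: "k \<le> Suc n \<Longrightarrow> integrable M (weight k)"
  by (rule bounded_integrable[of _ 1]) (auto intro: weight_measurable)

lemma weight_antimono: "j \<le> k \<Longrightarrow> weight k \<omega> \<le> weight j \<omega>"
  by (rule lift_Suc_antimono_le[of "\<lambda>k. weight k \<omega>"])
     (auto simp: weight_Suc intro: mult_left_le)

lemma mass_pos: "k \<le> Suc n \<Longrightarrow> 0 < mass k"
proof -
  assume k: "k \<le> Suc n"
  have "0 < mass (Suc n)"
    using survivors by (simp add: mass_def weight_def lessThan_Suc_atMost)
  also have "\<dots> \<le> mass k"
    unfolding mass_def by (rule integral_mono) (auto intro: integrable_weight weight_antimono k)
  finally show ?thesis .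
qed

text \<open>The Markov property as an identity of measures: as \<open>U\<close> depends only on the past of step
  \<open>Suc k\<close>, weighting by \<open>U\<close> does not disturb the transition from \<open>Z k\<close> to \<open>Z (Suc k)\<close>.\<close>

lemma one_step:
  assumes k: "Suc k \<le> n" and U: "U \<in> borel_measurable (history (Suc k))"
    and UC: "\<And>\<omega>. \<omega> \<in> space M \<Longrightarrow> 0 \<le> U \<omega> \<and> U \<omega> \<le> C"
  shows "distr (density M (\<lambda>\<omega>. ennreal (U \<omega>))) N (Z (Suc k))
       = distr (density M (\<lambda>\<omega>. ennreal (U \<omega>))) N (Z k) \<bind> K (Suc k)"
    (is "?L = ?D \<bind> K (Suc k)")
proof (rule measure_eqI)
  have k': "Suc k \<le> n" "k \<le> n" "Suc k \<le> Suc n" using k by auto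
  have UM [measurable]: "U \<in> borel_measurable M" using U k' history_measurable by blast
  note [measurable] = Z_measurable[OF k'(1)] Z_measurable[OF k'(2)]
  have K: "K (Suc k) \<in> N \<rightarrow>\<^sub>M prob_algebra N"
    using K_measurable[of "Suc k"] k by simp
  have Kk: "K (Suc k) \<in> N \<rightarrow>\<^sub>M subprob_algebra N"
    using K by (rule measurable_prob_algebraD)
  have ne: "space ?D \<noteq> {}"
    using not_empty measurable_space[OF Z_measurable[OF k'(1)]] by auto
  have KD: "K (Suc k) \<in> ?D \<rightarrow>\<^sub>M subprob_algebra N" using Kk by (simp cong: measurable_cong_sets)
  show "sets ?L = sets (?D \<bind> K (Suc k))"
    using sets_bind_measurable[OF KD ne] by simp
  fix A assume "A \<in> sets ?L"
  then have A [measurable]: "A \<in> sets N" by simp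
  interpret F: finite_measure_subalgebra M "history (Suc k)"
    by unfold_locales (rule subalgebra_history[OF k'(3)])
  let ?I = "\<lambda>\<omega>. indicator {\<omega>'. Z (Suc k) \<omega>' \<in> A} \<omega> :: real"
  let ?m = "\<lambda>\<omega>. measure (K (Suc k) (Z k \<omega>)) A"
  have mN: "(\<lambda>z. measure (K (Suc k) z) A) \<in> borel_measurable N"
    unfolding measure_def
    by (intro borel_measurable_enn2real measurable_compose[OF Kk measurable_emeasure_subprob_algebra] A)
  have m [measurable]: "?m \<in> borel_measurable M"
    by (rule measurable_compose[OF Z_measurable[OF k'(2)] mN])
  have I [measurable]: "?I \<in> borel_measurable M"
  proof -
    have "(\<lambda>\<omega>. indicator A (Z (Suc k) \<omega>) :: real) \<in> borel_measurable M" by measurable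
    then show ?thesis by (simp add: indicator_def)
  qed
  have AE: "AE \<omega> in M. real_cond_exp M (history (Suc k)) ?I \<omega> = ?m \<omega>"
    using chain k A unfolding markov_chain_def history_def by (auto dest!: bspec[of _ _ "Suc k"])
  have C: "0 \<le> C" using UC not_empty by (meson ex_in_conv order_trans)
  have int: "integrable M (\<lambda>\<omega>. U \<omega> * ?I \<omega>)"
    by (rule bounded_integrable[of _ C])
       (use UC C in \<open>auto intro!: AE_I2 split: split_indicator\<close>)
  have m1: "0 \<le> ?m \<omega>" "?m \<omega> \<le> 1" if "\<omega> \<in> space M" for \<omega>
    using measurable_space[OF K measurable_space[OF Z_measurable[OF k'(2)] that]]
    by (auto simp: space_prob_algebra intro: prob_space.prob_le_1)
  have eK: "emeasure (K (Suc k) (Z k \<omega>)) A = ennreal (?m \<omega>)" if "\<omega> \<in> space M" for \<omega>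
    using measurable_space[OF K measurable_space[OF Z_measurable[OF k'(2)] that]]
    by (auto simp: space_prob_algebra intro!: finite_measure.emeasure_eq_measure prob_space.finite_measure)
  have int': "integrable M (\<lambda>\<omega>. U \<omega> * ?m \<omega>)"
  proof (rule bounded_integrable[of _ C], measurable, rule AE_I2)
    fix \<omega> assume \<omega>: "\<omega> \<in> space M"
    show "\<bar>U \<omega> * ?m \<omega>\<bar> \<le> C"
      using UC[OF \<omega>] m1[OF \<omega>] C mult_mono[of "U \<omega>" C "?m \<omega>" 1] by (simp add: abs_mult)
  qed
  have "(\<integral>\<omega>. U \<omega> * ?I \<omega> \<partial>M) = (\<integral>\<omega>. U \<omega> * real_cond_exp M (history (Suc k)) ?I \<omega> \<partial>M)"
    using F.real_cond_exp_intg(2)[OF int U I] by simp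
  also have "\<dots> = (\<integral>\<omega>. U \<omega> * ?m \<omega> \<partial>M)"
    by (rule integral_cong_AE) (use AE in auto)
  finally have eq: "(\<integral>\<omega>. U \<omega> * ?I \<omega> \<partial>M) = (\<integral>\<omega>. U \<omega> * ?m \<omega> \<partial>M)" .
  have "emeasure ?L A = (\<integral>\<^sup>+\<omega>. ennreal (U \<omega> * ?I \<omega>) \<partial>M)"
    by (simp add: emeasure_distr emeasure_density)
       (auto intro!: nn_integral_cong simp: indicator_def)
  also have "\<dots> = (\<integral>\<^sup>+\<omega>. ennreal (U \<omega> * ?m \<omega>) \<partial>M)"
    using eq UC m1 by (subst (1 2) nn_integral_eq_integral) (auto intro: int int')
  also have "\<dots> = (\<integral>\<^sup>+\<omega>. ennreal (U \<omega>) * emeasure (K (Suc k) (Z k \<omega>)) A \<partial>M)"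
    by (rule nn_integral_cong) (use UC in \<open>simp add: eK ennreal_mult\<close>)
  also have "\<dots> = (\<integral>\<^sup>+z. emeasure (K (Suc k) z) A \<partial>?D)"
    by (subst nn_integral_distr)
       (auto simp: nn_integral_density measurable_emeasure_subprob_algebra
         intro!: measurable_compose[OF _ measurable_compose[OF Kk]] nn_integral_density[symmetric])
  also have "\<dots> = emeasure (?D \<bind> K (Suc k)) A"
    by (rule emeasure_bind[symmetric, OF ne KD A])
  finally show "emeasure ?L A = emeasure (?D \<bind> K (Suc k)) A" .
qed


lemma integral_one_step:
  fixes \<phi> :: "'a \<Rightarrow> real"
  assumes k: "Suc k \<le> n" and U: "U \<in> borel_measurable (history (Suc k))"
    and U01: "\<And>\<omega>. \<omega> \<in> space M \<Longrightarrow> 0 \<le> U \<omega> \<and> U \<omega> \<le> 1"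
    and \<phi>: "\<phi> \<in> borel_measurable N" and \<phi>01: "\<And>z. z \<in> space N \<Longrightarrow> 0 \<le> \<phi> z \<and> \<phi> z \<le> 1"
  shows "(\<integral>\<omega>. U \<omega> * \<phi> (Z (Suc k) \<omega>) \<partial>M) = (\<integral>\<omega>. U \<omega> * (\<integral>z. \<phi> z \<partial>K (Suc k) (Z k \<omega>)) \<partial>M)"
proof -
  let ?\<nu> = "density M (\<lambda>\<omega>. ennreal (U \<omega>))"
  have UM [measurable]: "U \<in> borel_measurable M" using history_measurable[OF U] k by simp
  have U0: "AE \<omega> in M. 0 \<le> U \<omega>" using U01 by auto
  have Zm [measurable]: "Z k \<in> M \<rightarrow>\<^sub>M N" "Z (Suc k) \<in> M \<rightarrow>\<^sub>M N" using Z_measurable k by auto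
  have K [measurable]: "K (Suc k) \<in> N \<rightarrow>\<^sub>M prob_algebra N"
    using K_measurable[of "Suc k"] k by simp
  have K1: "emeasure (K (Suc k) z) (space (K (Suc k) z)) \<le> ennreal 1" if "z \<in> space N" for z
    using measurable_space[OF K that] by (simp add: space_prob_algebra prob_space.emeasure_space_1)
  have K\<phi>: "(\<lambda>z. \<integral>z'. \<phi> z' \<partial>K (Suc k) z) \<in> borel_measurable N"
    by (rule measurable_compose[OF measurable_prob_algebraD[OF K] integral_measurable_subprob_algebra[OF \<phi>]])
  have fin: "finite_measure (distr ?\<nu> N (Z k))"
  proof (rule finite_measure.finite_measure_distr)
    have "emeasure ?\<nu> (space ?\<nu>) = (\<integral>\<^sup>+\<omega>. ennreal (U \<omega>) \<partial>M)"
      by (simp add: emeasure_density cong: nn_integral_cong)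
    also have "\<dots> \<le> (\<integral>\<^sup>+\<omega>. 1 \<partial>M)"
      by (rule nn_integral_mono) (use U01 in simp)
    finally show "finite_measure ?\<nu>"
      by (intro finite_measureI) (auto simp: emeasure_space_1 top_unique)
  qed simp
  have "(\<integral>\<omega>. U \<omega> * \<phi> (Z (Suc k) \<omega>) \<partial>M) = (\<integral>z. \<phi> z \<partial>distr ?\<nu> N (Z (Suc k)))"
    using U0 \<phi> by (simp add: integral_distr integral_density measurable_compose[OF Zm(2)])
  also have "\<dots> = (\<integral>z. \<phi> z \<partial>(distr ?\<nu> N (Z k) \<bind> K (Suc k)))"
    by (simp only: one_step[OF k U U01])
  also have "\<dots> = (\<integral>z. (\<integral>z'. \<phi> z' \<partial>K (Suc k) z) \<partial>distr ?\<nu> N (Z k))"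
    by (rule integral_bind[where K = N and B = 1 and B' = 1])
       (use \<phi> \<phi>01 fin K1 measurable_prob_algebraD[OF K] in \<open>auto cong: measurable_cong_sets\<close>)
  also have "\<dots> = (\<integral>\<omega>. U \<omega> * (\<integral>z. \<phi> z \<partial>K (Suc k) (Z k \<omega>)) \<partial>M)"
    using U0 K\<phi> by (simp add: integral_distr integral_density measurable_compose[OF Zm(1)])
  finally show ?thesis .
qed

abbreviation future :: "nat \<Rightarrow> 'w \<Rightarrow> real" where
  "future k \<omega> \<equiv> \<Prod>p\<in>{k+1..n}. g p (Z p \<omega>)"

text \<open>The Markov property over several steps, in integrated form: some function of $Z_k$ alone is the
  conditional expectation of the remaining potentials given the whole past. It arises by backward
  recursion through the kernels, $r_k(z)=\int g_{k+1}r_{k+1}\,dK_{k+1}(z)$, since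
  the potential at step $k+1$ can be absorbed in the test function for step $k+1$.\<close>

lemma survival_from_history:
  assumes "k \<le> n"
  shows "\<exists>r \<in> unit_measurable N. \<forall>U \<in> unit_measurable (history (Suc k)).
     (\<integral>\<omega>. U \<omega> * future k \<omega> \<partial>M) = (\<integral>\<omega>. U \<omega> * r (Z k \<omega>) \<partial>M)"
  using assms
proof (induction k rule: inc_induct)
  case base
  show ?case by (rule bexI[of _ "\<lambda>_. 1"]) (auto intro: unit_measurableI)
next
  case (step k)
  then obtain r where r_unit: "r \<in> unit_measurable N"
    and rU: "\<And>U. U \<in> unit_measurable (history (Suc (Suc k))) \<Longrightarrow>
        (\<integral>\<omega>. U \<omega> * future (Suc k) \<omega> \<partial>M) = (\<integral>\<omega>. U \<omega> * r (Z (Suc k) \<omega>) \<partial>M)"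
    by blast
  note r [measurable] = unit_measurableD(1)[OF r_unit] and r01 = unit_measurableD(2)[OF r_unit]
  have k: "Suc k \<le> n" using step by simp
  have K: "K (Suc k) \<in> N \<rightarrow>\<^sub>M prob_algebra N"
    using K_measurable[of "Suc k"] k by simp
  define \<phi> where "\<phi> z = g (Suc k) z * r z" for z
  have \<phi>: "\<phi> \<in> borel_measurable N" unfolding \<phi>_def using g_measurable[OF k] by measurable
  have \<phi>01: "0 \<le> \<phi> z \<and> \<phi> z \<le> 1" if "z \<in> space N" for z
    using r01[OF that] by (auto simp: \<phi>_def intro: mult_le_one)
  let ?r = "\<lambda>z. \<integral>z'. \<phi> z' \<partial>K (Suc k) z"
  show ?case
  proof (intro bexI[of _ ?r] ballI unit_measurableI conjI)
    show "?r \<in> borel_measurable N"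
      by (rule measurable_compose[OF measurable_prob_algebraD[OF K] integral_measurable_subprob_algebra[OF \<phi>]])
  next
    fix z assume "z \<in> space N"
    then have p: "prob_space (K (Suc k) z)" and s: "sets (K (Suc k) z) = sets N"
      using measurable_space[OF K] by (auto simp: space_prob_algebra)
    have \<phi>01': "0 \<le> \<phi> z' \<and> \<phi> z' \<le> 1" if "z' \<in> space (K (Suc k) z)" for z'
      using \<phi>01 that sets_eq_imp_space_eq[OF s] by auto
    show "0 \<le> ?r z" by (rule integral_nonneg_AE) (use \<phi>01' in auto)
    show "?r z \<le> 1"
      by (rule prob_space.integral_le_const[OF p], rule finite_measure.integrable_const_bound[of _ _ 1])
         (use \<phi>01' \<phi> s p in \<open>auto simp: prob_space.finite_measure cong: measurable_cong_sets\<close>)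
  next
    fix U assume U: "U \<in> unit_measurable (history (Suc k))"
    note U01 = unit_measurableD(2)[OF U, unfolded space_history]
    have split: "{k+1..n} = insert (Suc k) {Suc k+1..n}" using k by auto
    have U': "(\<lambda>\<omega>. U \<omega> * g (Suc k) (Z (Suc k) \<omega>)) \<in> unit_measurable (history (Suc (Suc k)))"
    proof (rule unit_measurableI)
      show "(\<lambda>\<omega>. U \<omega> * g (Suc k) (Z (Suc k) \<omega>)) \<in> borel_measurable (history (Suc (Suc k)))"
        using history_mono[OF unit_measurableD(1)[OF U]] measurable_compose[OF Z_history g_measurable[OF k]] k
        by (intro borel_measurable_times) auto
    qed (use U01 in \<open>auto intro: mult_le_one\<close>)
    have "(\<integral>\<omega>. U \<omega> * future k \<omega> \<partial>M)
        = (\<integral>\<omega>. (U \<omega> * g (Suc k) (Z (Suc k) \<omega>)) * future (Suc k) \<omega> \<partial>M)"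
      unfolding split by (simp add: mult.assoc)
    also have "\<dots> = (\<integral>\<omega>. (U \<omega> * g (Suc k) (Z (Suc k) \<omega>)) * r (Z (Suc k) \<omega>) \<partial>M)"
      by (rule rU[OF U'])
    also have "\<dots> = (\<integral>\<omega>. U \<omega> * \<phi> (Z (Suc k) \<omega>) \<partial>M)"
      by (simp add: \<phi>_def mult.assoc)
    also have "\<dots> = (\<integral>\<omega>. U \<omega> * ?r (Z k \<omega>) \<partial>M)"
      by (rule integral_one_step[OF k unit_measurableD(1)[OF U] U01 \<phi> \<phi>01])
    finally show "(\<integral>\<omega>. U \<omega> * future k \<omega> \<partial>M) = (\<integral>\<omega>. U \<omega> * ?r (Z k \<omega>) \<partial>M)" .
  qed
qed

text \<open>For $k<n$ the survival function $R_k$ is specified only through conditioning on $Z_k$. Since the events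
  generated by $Z_k$ belong to the past, $R_k(Z_k)$ must agree almost surely with the function found by
  backward recursion; so it inherits the values in $[0,1]$ and the conditioning on the whole past.\<close>

lemma bounded_survival:
  assumes k: "k \<le> n"
  obtains r where "r \<in> unit_measurable N" "AE \<omega> in M. R k (Z k \<omega>) = r (Z k \<omega>)"
    "\<And>U. U \<in> unit_measurable (history (Suc k)) \<Longrightarrow>
        (\<integral>\<omega>. U \<omega> * future k \<omega> \<partial>M) = (\<integral>\<omega>. U \<omega> * r (Z k \<omega>) \<partial>M)"
proof (cases "k = n")
  case True
  have "AE \<omega> in M. R k (Z k \<omega>) = 1"
    using survival measurable_space[OF Z_measurable[OF k]] True by (auto simp: survival_functions_def)
  then show thesis
    by (intro that[of "\<lambda>_. 1"]) (auto simp: True intro: unit_measurableI)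
next
  case False
  obtain r where r_unit: "r \<in> unit_measurable N"
    and rU: "\<And>U. U \<in> unit_measurable (history (Suc k)) \<Longrightarrow>
        (\<integral>\<omega>. U \<omega> * future k \<omega> \<partial>M) = (\<integral>\<omega>. U \<omega> * r (Z k \<omega>) \<partial>M)"
    using survival_from_history[OF k] by blast
  note r = unit_measurableD(1)[OF r_unit] and r01 = unit_measurableD(2)[OF r_unit]
  let ?V = "vimage_algebra (space M) (Z k) N"
  have Zsp: "Z k \<in> space M \<rightarrow> space N" using measurable_space[OF Z_measurable[OF k]] by auto
  have V: "subalgebra (history (Suc k)) ?V"
    using measurable_sets[OF Z_history[of k "Suc k"]] k
    by (auto simp: subalgebra_def sets_vimage_algebra2[OF Zsp])
  have V': "subalgebra M ?V"
    using V subalgebra_history[of "Suc k"] k by (auto simp: subalgebra_def)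
  interpret V: finite_measure_subalgebra M ?V by unfold_locales (rule V')
  have rZ: "(\<lambda>\<omega>. r (Z k \<omega>)) \<in> borel_measurable M"
    by (rule measurable_compose[OF Z_measurable[OF k] r])
  have future: "future k \<in> borel_measurable M"
    by (rule borel_measurable_prod, rule measurable_compose[OF Z_measurable g_measurable]) auto
  have "AE \<omega> in M. real_cond_exp M ?V (future k) \<omega> = r (Z k \<omega>)"
  proof (rule V.real_cond_exp_charact)
    fix A assume "A \<in> sets ?V"
    then have "(indicator A :: 'w \<Rightarrow> real) \<in> unit_measurable (history (Suc k))"
      using V by (auto simp: subalgebra_def intro!: unit_measurableI split: split_indicator)
    from rU[OF this] show "(\<integral>\<omega>\<in>A. future k \<omega> \<partial>M) = (\<integral>\<omega>\<in>A. r (Z k \<omega>) \<partial>M)"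
      by (simp add: set_lebesgue_integral_def)
  next
    show "integrable M (future k)"
      by (rule bounded_integrable[OF future, of 1]) (auto simp: abs_prod intro!: AE_I2 prod_le_1)
    show "integrable M (\<lambda>\<omega>. r (Z k \<omega>))"
      by (rule bounded_integrable[OF rZ, of 1])
         (use r01 measurable_space[OF Z_measurable[OF k]] in \<open>auto intro!: AE_I2\<close>)
    show "(\<lambda>\<omega>. r (Z k \<omega>)) \<in> borel_measurable ?V"
      by (rule measurable_compose[OF measurable_vimage_algebra1[OF Zsp] r])
  qed
  moreover have "AE \<omega> in M. real_cond_exp M ?V (future k) \<omega> = R k (Z k \<omega>)"
    using survival False k by (auto simp: survival_functions_def cond_exp_given_def)
  ultimately have "AE \<omega> in M. R k (Z k \<omega>) = r (Z k \<omega>)"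
    by eventually_elim simp
  then show thesis by (rule that[OF r_unit _ rU])
qed

definition second_moment :: "nat \<Rightarrow> real" where
  "second_moment k = (\<integral>\<omega>. (R k (Z k \<omega>))\<^sup>2 * weight (Suc k) \<omega> \<partial>M)"

lemma R_measurable: "k \<le> n \<Longrightarrow> R k \<in> borel_measurable N"
proof (cases "k = n")
  case True
  have "R n \<in> borel_measurable N \<longleftrightarrow> (\<lambda>_. 1 :: real) \<in> borel_measurable N"
    by (rule measurable_cong) (use survival in \<open>auto simp: survival_functions_def\<close>)
  then show ?thesis by (simp add: True)
qed (use survival in \<open>auto simp: survival_functions_def cond_exp_given_def\<close>)

lemma integral_reweighted:
  fixes \<phi> :: "'a \<Rightarrow> real"
  assumes "k \<le> n" "j \<le> Suc n" "\<phi> \<in> borel_measurable N"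
  shows "(\<integral>z. \<phi> z \<partial>distr (density M (\<lambda>\<omega>. ennreal (weight j \<omega> / mass j))) N (Z k))
       = (\<integral>\<omega>. \<phi> (Z k \<omega>) * weight j \<omega> \<partial>M) / mass j"
proof -
  have [measurable]: "weight j \<in> borel_measurable M" using assms weight_measurable by simp
  have "(\<integral>z. \<phi> z \<partial>distr (density M (\<lambda>\<omega>. ennreal (weight j \<omega> / mass j))) N (Z k))
      = (\<integral>\<omega>. (\<phi> (Z k \<omega>) * weight j \<omega>) / mass j \<partial>M)"
    using assms Z_measurable[OF assms(1)] mass_pos[OF assms(2)]
    by (simp add: integral_distr integral_density measurable_compose[OF Z_measurable[OF assms(1)]] mult.commute)
  then show ?thesis by simp
qed

lemma normalized_feynman_kac:
  assumes k: "k \<le> n"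
  shows "normalized (feynman_kac M N g Z k)
       = distr (density M (\<lambda>\<omega>. ennreal (weight (Suc k) \<omega> / mass (Suc k)))) N (Z k)"
proof -
  let ?c = "mass (Suc k)"
  have c: "0 < ?c" using mass_pos k by simp
  have [measurable]: "weight (Suc k) \<in> borel_measurable M" using k weight_measurable by simp
  note [measurable] = Z_measurable[OF k]
  have fk: "feynman_kac M N g Z k = distr (density M (\<lambda>\<omega>. ennreal (weight (Suc k) \<omega>))) N (Z k)"
    by (simp add: feynman_kac_def weight_def lessThan_Suc_atMost)
  have "emeasure (feynman_kac M N g Z k) (space (feynman_kac M N g Z k)) = (\<integral>\<^sup>+\<omega>. ennreal (weight (Suc k) \<omega>) \<partial>M)"
  proof -
    have "Z k -` space N \<inter> space M = space M" using measurable_space[OF Z_measurable[OF k]] by auto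
    then show ?thesis
      by (simp add: fk emeasure_distr emeasure_density cong: nn_integral_cong)
  qed
  also have "\<dots> = ennreal ?c"
    using integrable_weight[of "Suc k"] k by (simp add: nn_integral_eq_integral mass_def)
  finally have total: "emeasure (feynman_kac M N g Z k) (space (feynman_kac M N g Z k)) = ennreal ?c" .
  have inv: "1 / ennreal ?c = ennreal (1 / ?c)"
    using c by (simp add: divide_ennreal flip: ennreal_1)
  show ?thesis
  proof (rule measure_eqI)
    fix A assume "A \<in> sets (normalized (feynman_kac M N g Z k))"
    then have [measurable]: "A \<in> sets N" by (simp add: normalized_def fk)
    have "emeasure (normalized (feynman_kac M N g Z k)) A
        = ennreal (1 / ?c) * (\<integral>\<^sup>+\<omega>. ennreal (weight (Suc k) \<omega>) * indicator (Z k -` A \<inter> space M) \<omega> \<partial>M)"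
      unfolding normalized_def total inv by (simp add: fk emeasure_distr emeasure_density)
    also have "\<dots> = (\<integral>\<^sup>+\<omega>. ennreal (1 / ?c) * (ennreal (weight (Suc k) \<omega>) * indicator (Z k -` A \<inter> space M) \<omega>) \<partial>M)"
      by (rule nn_integral_cmult[symmetric]) measurable
    also have "\<dots> = (\<integral>\<^sup>+\<omega>. ennreal (weight (Suc k) \<omega> / ?c) * indicator (Z k -` A \<inter> space M) \<omega> \<partial>M)"
    proof (rule nn_integral_cong)
      fix \<omega>
      have "ennreal (1 / ?c) * ennreal (weight (Suc k) \<omega>) = ennreal (weight (Suc k) \<omega> / ?c)"
        using c by (simp flip: ennreal_mult)
      then show "ennreal (1 / ?c) * (ennreal (weight (Suc k) \<omega>) * indicator (Z k -` A \<inter> space M) \<omega>)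
          = ennreal (weight (Suc k) \<omega> / ?c) * indicator (Z k -` A \<inter> space M) \<omega>"
        by (simp add: mult.assoc[symmetric])
    qed
    finally show "emeasure (normalized (feynman_kac M N g Z k)) A
      = emeasure (distr (density M (\<lambda>\<omega>. ennreal (weight (Suc k) \<omega> / ?c))) N (Z k)) A"
      by (simp add: emeasure_distr emeasure_density)
  qed (simp add: normalized_def fk)
qed

lemma predicted_eq:
  assumes k: "k \<le> n"
  shows "predicted M N g Z K k = distr (density M (\<lambda>\<omega>. ennreal (weight k \<omega> / mass k))) N (Z k)"
proof (cases k)
  case 0
  have "density M (\<lambda>\<omega>. ennreal (weight 0 \<omega> / mass 0)) = M"
    by (simp add: weight_def mass_def prob_space density_1)
  then show ?thesis by (simp add: predicted_def 0)
next
  case (Suc j)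
  have m: "0 < mass k" using mass_pos k by simp
  have "(\<lambda>\<omega>. weight k \<omega> / mass k) \<in> borel_measurable (history k)"
    using weight_history[of k] k by simp
  moreover have "0 \<le> weight k \<omega> / mass k \<and> weight k \<omega> / mass k \<le> 1 / mass k" for \<omega>
    using m by (simp add: divide_right_mono)
  ultimately show ?thesis
    using one_step[of j "\<lambda>\<omega>. weight k \<omega> / mass k" "1 / mass k"] k
    by (simp add: predicted_def normalized_feynman_kac Suc)
qed

lemma weight_unit: "k \<le> n \<Longrightarrow> weight (Suc k) \<in> unit_measurable (history (Suc k))"
  by (rule unit_measurableI) (auto intro: weight_history)

text \<open>Independent of \<open>k\<close>: surviving up to \<open>k\<close> and then onwards is surviving to the end.\<close>

lemma expected_survival:
  assumes k: "k \<le> n"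
  shows "(\<integral>\<omega>. R k (Z k \<omega>) * weight (Suc k) \<omega> \<partial>M) = mass (Suc n)"
proof -
  obtain r where r: "r \<in> unit_measurable N"
    and R: "AE \<omega> in M. R k (Z k \<omega>) = r (Z k \<omega>)"
    and rU: "\<And>U. U \<in> unit_measurable (history (Suc k)) \<Longrightarrow>
        (\<integral>\<omega>. U \<omega> * future k \<omega> \<partial>M) = (\<integral>\<omega>. U \<omega> * r (Z k \<omega>) \<partial>M)"
    using bounded_survival[OF k] by blast
  have [measurable]: "weight (Suc k) \<in> borel_measurable M" using k weight_measurable by simp
  note [measurable] = measurable_compose[OF Z_measurable[OF k] R_measurable[OF k]]
    measurable_compose[OF Z_measurable[OF k] unit_measurableD(1)[OF r]]
  have w: "weight (Suc n) \<omega> = weight (Suc k) \<omega> * future k \<omega>" for \<omega>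
  proof -
    have split: "{..<Suc n} = {..<Suc k} \<union> {k+1..n}" using k by auto
    show ?thesis
      unfolding weight_def split by (rule prod.union_disjoint) auto
  qed
  have "mass (Suc n) = (\<integral>\<omega>. weight (Suc k) \<omega> * r (Z k \<omega>) \<partial>M)"
    unfolding mass_def w by (rule rU[OF weight_unit[OF k]])
  also have "\<dots> = (\<integral>\<omega>. R k (Z k \<omega>) * weight (Suc k) \<omega> \<partial>M)"
    by (rule integral_cong_AE) (use R in auto)
  finally show ?thesis by simp
qed

text \<open>The relative variance at step \<open>k\<close> is $A_k-1$ with $A_k$ the normalized second moment, and
  $(1/p_k-1)+(A_k-1)/p_k=A_k/p_k-1$.\<close>

lemma variance_formula_moments:
  assumes p: "\<And>k. k \<le> n \<Longrightarrow> p k = mass (Suc k) / mass k"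
  shows "variance_formula n p (\<lambda>k. normalized (feynman_kac M N g Z k)) R
       = (\<Sum>k\<le>n. second_moment k * mass k / (mass (Suc n))\<^sup>2 - 1)"
  unfolding variance_formula_def sum.distrib[symmetric]
proof (rule sum.cong[OF refl])
  fix k assume "k \<in> {..n}"
  then have k: "k \<le> n" by simp
  have pos: "0 < mass k" "0 < mass (Suc k)" "0 < mass (Suc n)" using k by (auto intro: mass_pos)
  let ?\<mu> = "normalized (feynman_kac M N g Z k)"
  have 1: "(\<integral>z. R k z \<partial>?\<mu>) = mass (Suc n) / mass (Suc k)"
    using k R_measurable by (simp add: normalized_feynman_kac integral_reweighted expected_survival)
  have 2: "(\<integral>z. (R k z)\<^sup>2 \<partial>?\<mu>) = second_moment k / mass (Suc k)"
    using k R_measurable by (simp add: normalized_feynman_kac integral_reweighted second_moment_def)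
  show "1 / p k - 1 + 1 / p k * (Var (R k) ?\<mu> / (\<integral>z. R k z \<partial>?\<mu>)\<^sup>2)
      = second_moment k * mass k / (mass (Suc n))\<^sup>2 - 1"
    unfolding Var_def 1 2 p[OF k] using pos by (simp add: field_simps power2_eq_square)
qed

lemma predicted_survival:
  assumes k: "k \<le> n"
  shows "(\<integral>z. g k z \<partial>predicted M N g Z K k) = mass (Suc k) / mass k"
    and "(\<integral>z. (g k z * R k z)\<^sup>2 \<partial>predicted M N g Z K k) / (\<integral>z. g k z * R k z \<partial>predicted M N g Z K k)\<^sup>2
       = second_moment k * mass k / (mass (Suc n))\<^sup>2"
proof -
  note m = R_measurable[OF k] g_measurable[OF k]
  show "(\<integral>z. g k z \<partial>predicted M N g Z K k) = mass (Suc k) / mass k"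
    using k m by (simp add: predicted_eq integral_reweighted) (simp add: mass_def weight_Suc mult.commute)
  have 1: "(\<integral>z. g k z * R k z \<partial>predicted M N g Z K k) = mass (Suc n) / mass k"
    using k m expected_survival[OF k]
    by (simp add: predicted_eq integral_reweighted weight_Suc mult_ac)
  \<comment> \<open>The squared potential is the potential, so the square again carries the weight of the next index.\<close>
  have sq: "(g k z)\<^sup>2 = g k z" for z using g_binary[of k z] by auto
  have 2: "(\<integral>z. (g k z * R k z)\<^sup>2 \<partial>predicted M N g Z K k) = second_moment k / mass k"
    using k m by (simp add: predicted_eq integral_reweighted second_moment_def weight_Suc power_mult_distrib sq mult_ac)
  show "(\<integral>z. (g k z * R k z)\<^sup>2 \<partial>predicted M N g Z K k) / (\<integral>z. g k z * R k z \<partial>predicted M N g Z K k)\<^sup>2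
       = second_moment k * mass k / (mass (Suc n))\<^sup>2"
    unfolding 1 2 using mass_pos[of k] k by (simp add: field_simps power2_eq_square)
qed

end

section \<open>Comparing two chains\<close>

text \<open>The second chain lies in the past of the first only up to null sets, as the versions of
  its components need not be functions of the first chain everywhere.\<close>

locale coarser_chain =
  fine: feynman_kac_chain M N n Z K g R + coarse: feynman_kac_chain M N' n Z' K' g' R'
  for M :: "'w measure" and N :: "'a measure" and N' :: "'b measure"
    and n Z Z' K K' g g' R R' +
  assumes same_potential: "p \<le> n \<Longrightarrow> \<omega> \<in> space M \<Longrightarrow> g' p (Z' p \<omega>) = g p (Z p \<omega>)"
    and adapted: "k \<le> n \<Longrightarrow> \<exists>Y \<in> fine.history (Suc k) \<rightarrow>\<^sub>M N'. AE \<omega> in M. Z' k \<omega> = Y \<omega>"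
begin

lemma same_weight: "k \<le> Suc n \<Longrightarrow> \<omega> \<in> space M \<Longrightarrow> coarse.weight k \<omega> = fine.weight k \<omega>"
  unfolding coarse.weight_def fine.weight_def by (rule prod.cong) (auto intro: same_potential)

lemma same_mass: "k \<le> Suc n \<Longrightarrow> coarse.mass k = fine.mass k"
  unfolding coarse.mass_def fine.mass_def
  by (rule Bochner_Integration.integral_cong) (auto intro: same_weight)

text \<open>Write $s=E[G|\mathcal{H}]$ and $s'=E[G|\mathcal{H}']$ for the two survival functions along the
  chains. Testing $G$ with $ws'$ in either past gives $E[ws's]=E[ws'^2]$, and expanding
  $0\le E[w(s-s')^2]$ then gives $E[ws'^2]\le E[ws^2]$.\<close>

lemma second_moment_le:
  assumes k: "k \<le> n"
  shows "coarse.second_moment k \<le> fine.second_moment k"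
proof -
  obtain r where r_unit: "r \<in> unit_measurable N"
    and R: "AE \<omega> in M. R k (Z k \<omega>) = r (Z k \<omega>)"
    and rU: "\<And>U. U \<in> unit_measurable (fine.history (Suc k)) \<Longrightarrow>
        (\<integral>\<omega>. U \<omega> * fine.future k \<omega> \<partial>M) = (\<integral>\<omega>. U \<omega> * r (Z k \<omega>) \<partial>M)"
    using fine.bounded_survival[OF k] by blast
  obtain r' where r'_unit: "r' \<in> unit_measurable N'"
    and R': "AE \<omega> in M. R' k (Z' k \<omega>) = r' (Z' k \<omega>)"
    and rU': "\<And>U. U \<in> unit_measurable (coarse.history (Suc k)) \<Longrightarrow>
        (\<integral>\<omega>. U \<omega> * coarse.future k \<omega> \<partial>M) = (\<integral>\<omega>. U \<omega> * r' (Z' k \<omega>) \<partial>M)"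
    using coarse.bounded_survival[OF k] by blast
  obtain Y where Y: "Y \<in> fine.history (Suc k) \<rightarrow>\<^sub>M N'" and Y_eq: "AE \<omega> in M. Z' k \<omega> = Y \<omega>"
    using adapted[OF k] by blast
  have YM: "Y \<in> M \<rightarrow>\<^sub>M N'" using fine.history_measurable[OF Y] k by simp
  let ?w = "fine.weight (Suc k)"
  let ?s = "\<lambda>\<omega>. r (Z k \<omega>)" and ?s' = "\<lambda>\<omega>. r' (Z' k \<omega>)"
  have [measurable]: "?w \<in> borel_measurable M"
    using fine.weight_measurable k by simp
  have [measurable]: "?s \<in> borel_measurable M" "?s' \<in> borel_measurable M" "(\<lambda>\<omega>. r' (Y \<omega>)) \<in> borel_measurable M"
    using measurable_compose[OF fine.Z_measurable[OF k] unit_measurableD(1)[OF r_unit]]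
      measurable_compose[OF coarse.Z_measurable[OF k] unit_measurableD(1)[OF r'_unit]]
      measurable_compose[OF YM unit_measurableD(1)[OF r'_unit]] by auto
  have [measurable]: "(\<lambda>\<omega>. R k (Z k \<omega>)) \<in> borel_measurable M" "(\<lambda>\<omega>. R' k (Z' k \<omega>)) \<in> borel_measurable M"
    using measurable_compose[OF fine.Z_measurable[OF k] fine.R_measurable[OF k]]
      measurable_compose[OF coarse.Z_measurable[OF k] coarse.R_measurable[OF k]] by auto
  have [measurable]: "coarse.weight (Suc k) \<in> borel_measurable M"
    using coarse.weight_measurable k by simp
  have [measurable]: "fine.future k \<in> borel_measurable M"
    by (rule borel_measurable_prod, rule measurable_compose[OF fine.Z_measurable fine.g_measurable]) auto
  have s01: "0 \<le> ?s \<omega> \<and> ?s \<omega> \<le> 1" and s'01: "0 \<le> ?s' \<omega> \<and> ?s' \<omega> \<le> 1" and Y01: "0 \<le> r' (Y \<omega>) \<and> r' (Y \<omega>) \<le> 1"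
    if "\<omega> \<in> space M" for \<omega>
    using that unit_measurableD(2)[OF r_unit] unit_measurableD(2)[OF r'_unit] measurable_space[OF YM]
      measurable_space[OF fine.Z_measurable[OF k]] measurable_space[OF coarse.Z_measurable[OF k]] by auto
  have U': "(\<lambda>\<omega>. coarse.weight (Suc k) \<omega> * ?s' \<omega>) \<in> unit_measurable (coarse.history (Suc k))"
  proof (rule unit_measurableI)
    show "(\<lambda>\<omega>. coarse.weight (Suc k) \<omega> * ?s' \<omega>) \<in> borel_measurable (coarse.history (Suc k))"
      using k by (intro borel_measurable_times coarse.weight_history
          measurable_compose[OF coarse.Z_history unit_measurableD(1)[OF r'_unit]]) auto
  qed (use s'01 in \<open>auto intro: mult_le_one\<close>)
  have U: "(\<lambda>\<omega>. ?w \<omega> * r' (Y \<omega>)) \<in> unit_measurable (fine.history (Suc k))"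
  proof (rule unit_measurableI)
    show "(\<lambda>\<omega>. ?w \<omega> * r' (Y \<omega>)) \<in> borel_measurable (fine.history (Suc k))"
      using k by (intro borel_measurable_times fine.weight_history
          measurable_compose[OF Y unit_measurableD(1)[OF r'_unit]]) auto
  qed (use Y01 in \<open>auto intro: mult_le_one\<close>)
  have future: "coarse.future k \<omega> = fine.future k \<omega>" if "\<omega> \<in> space M" for \<omega>
    using that by (intro prod.cong) (auto intro: same_potential)
  have "(\<integral>\<omega>. (coarse.weight (Suc k) \<omega> * ?s' \<omega>) * ?s' \<omega> \<partial>M)
      = (\<integral>\<omega>. (coarse.weight (Suc k) \<omega> * ?s' \<omega>) * coarse.future k \<omega> \<partial>M)"
    by (rule rU'[OF U', symmetric])
  also have "\<dots> = (\<integral>\<omega>. (?w \<omega> * ?s' \<omega>) * fine.future k \<omega> \<partial>M)"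
  proof (rule Bochner_Integration.integral_cong[OF refl])
    fix \<omega> assume "\<omega> \<in> space M"
    then show "(coarse.weight (Suc k) \<omega> * ?s' \<omega>) * coarse.future k \<omega> = (?w \<omega> * ?s' \<omega>) * fine.future k \<omega>"
      using future[of \<omega>] same_weight[of "Suc k" \<omega>] k by simp
  qed
  also have "\<dots> = (\<integral>\<omega>. (?w \<omega> * r' (Y \<omega>)) * fine.future k \<omega> \<partial>M)"
    by (rule integral_cong_AE, measurable) (use Y_eq in auto)
  also have "\<dots> = (\<integral>\<omega>. (?w \<omega> * r' (Y \<omega>)) * ?s \<omega> \<partial>M)"
    by (rule rU[OF U])
  also have "\<dots> = (\<integral>\<omega>. ?w \<omega> * (?s' \<omega> * ?s \<omega>) \<partial>M)"
    by (rule integral_cong_AE) (use Y_eq in auto)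
  finally have cross: "(\<integral>\<omega>. ?w \<omega> * (?s' \<omega> * ?s \<omega>) \<partial>M) = (\<integral>\<omega>. (coarse.weight (Suc k) \<omega> * ?s' \<omega>) * ?s' \<omega> \<partial>M)"
    by simp
  have coarse2: "coarse.second_moment k = (\<integral>\<omega>. (coarse.weight (Suc k) \<omega> * ?s' \<omega>) * ?s' \<omega> \<partial>M)"
    unfolding coarse.second_moment_def
    by (rule integral_cong_AE) (use R' in \<open>auto simp: power2_eq_square\<close>)
  also have "\<dots> = (\<integral>\<omega>. ?w \<omega> * (?s' \<omega>)\<^sup>2 \<partial>M)"
    by (rule Bochner_Integration.integral_cong) (use k in \<open>auto simp: same_weight power2_eq_square\<close>)
  finally have coarse2': "coarse.second_moment k = (\<integral>\<omega>. ?w \<omega> * (?s' \<omega>)\<^sup>2 \<partial>M)" .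
  have fine2: "fine.second_moment k = (\<integral>\<omega>. ?w \<omega> * (?s \<omega>)\<^sup>2 \<partial>M)"
    unfolding fine.second_moment_def by (rule integral_cong_AE) (use R in auto)
  have int: "integrable M (\<lambda>\<omega>. ?w \<omega> * f \<omega>)"
    if "f \<in> borel_measurable M" "\<And>\<omega>. \<omega> \<in> space M \<Longrightarrow> 0 \<le> f \<omega> \<and> f \<omega> \<le> 1" for f
    using that by (intro fine.bounded_integrable[of _ 1]) (auto intro!: AE_I2 mult_le_one simp: abs_mult)
  have ints: "integrable M (\<lambda>\<omega>. ?w \<omega> * (?s \<omega>)\<^sup>2)" "integrable M (\<lambda>\<omega>. ?w \<omega> * (?s' \<omega>)\<^sup>2)"
    "integrable M (\<lambda>\<omega>. ?w \<omega> * (?s' \<omega> * ?s \<omega>))"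
    by (rule int, measurable, use s01 s'01 in \<open>auto intro: mult_le_one power_le_one\<close>)+
  have "0 \<le> (\<integral>\<omega>. ?w \<omega> * (?s \<omega> - ?s' \<omega>)\<^sup>2 \<partial>M)"
    by (rule integral_nonneg_AE) auto
  also have "\<dots> = (\<integral>\<omega>. ?w \<omega> * (?s \<omega>)\<^sup>2 + ?w \<omega> * (?s' \<omega>)\<^sup>2 - 2 * (?w \<omega> * (?s' \<omega> * ?s \<omega>)) \<partial>M)"
    by (rule Bochner_Integration.integral_cong) (auto simp: power2_eq_square algebra_simps)
  also have "\<dots> = fine.second_moment k + coarse.second_moment k - 2 * coarse.second_moment k"
    using ints by (simp add: cross flip: fine2 coarse2' coarse2)
  finally show ?thesis by simp
qed

lemma variance_le:
  assumes p: "\<And>k. k \<le> n \<Longrightarrow> p k = coarse.mass (Suc k) / coarse.mass k"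
  shows "variance_formula n p (\<lambda>k. normalized (feynman_kac M N' g' Z' k)) R'
       \<le> variance_formula n p (\<lambda>k. normalized (feynman_kac M N g Z k)) R"
proof -
  have p': "p k = fine.mass (Suc k) / fine.mass k" if "k \<le> n" for k
    using p that by (simp add: same_mass)
  show ?thesis
  proof (subst coarse.variance_formula_moments[of p, OF p], assumption,
      subst fine.variance_formula_moments[of p, OF p'], assumption, rule sum_mono)
    fix k assume "k \<in> {..n}"
    then have k: "k \<le> n" by simp
    show "coarse.second_moment k * coarse.mass k / (coarse.mass (Suc n))\<^sup>2 - 1
        \<le> fine.second_moment k * fine.mass k / (fine.mass (Suc n))\<^sup>2 - 1"
      using second_moment_le[OF k] fine.mass_pos[of k] k
      by (simp add: same_mass divide_right_mono mult_right_mono)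
  qed
qed

end

section \<open>Path segments\<close>

text \<open>Evaluation $(f,x)\mapsto f(x)$ is jointly continuous for the supremum norm. Continuity is
  the route to measurability of functions of a segment because the space of bounded
  continuous functions on the line is not separable, so that its Borel sets are not generated by the evaluations.\<close>

lemma tendsto_apply_bcontfun:
  fixes f :: "'i \<Rightarrow> ('b::t2_space \<Rightarrow>\<^sub>C 'c::metric_space)"
  assumes f: "(f \<longlongrightarrow> l) F" and x: "(x \<longlongrightarrow> a) F"
  shows "((\<lambda>i. apply_bcontfun (f i) (x i)) \<longlongrightarrow> apply_bcontfun l a) F"
proof -
  have "isCont (apply_bcontfun l) a"
    using continuous_on_apply_bcontfun[of UNIV l] continuous_on_eq_continuous_at[OF open_UNIV] by blast
  then have "((\<lambda>i. apply_bcontfun l (x i)) \<longlongrightarrow> apply_bcontfun l a) F"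
    using x by (rule isCont_tendsto_compose)
  then have lim: "((\<lambda>i. dist (f i) l + dist (apply_bcontfun l (x i)) (apply_bcontfun l a)) \<longlongrightarrow> 0 + 0) F"
    using f by (intro tendsto_add) (auto simp: tendsto_dist_iff[symmetric])
  have "dist (apply_bcontfun (f i) (x i)) (apply_bcontfun l a)
      \<le> dist (f i) l + dist (apply_bcontfun l (x i)) (apply_bcontfun l a)" for i
    using dist_triangle[of "apply_bcontfun (f i) (x i)" "apply_bcontfun l a" "apply_bcontfun l (x i)"]
      dist_bounded[of "f i" "x i" l] by linarith
  then have "((\<lambda>i. dist (apply_bcontfun (f i) (x i)) (apply_bcontfun l a)) \<longlongrightarrow> 0) F"
    using lim by (intro tendsto_0_le[OF lim[simplified], of _ 1] always_eventually) auto
  then show ?thesis by (subst tendsto_dist_iff)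
qed

lemma continuous_on_apply_bcontfun_pair [continuous_intros]:
  fixes f :: "'i::topological_space \<Rightarrow> ('b::t2_space \<Rightarrow>\<^sub>C 'c::metric_space)"
  assumes "continuous_on S f" "continuous_on S x"
  shows "continuous_on S (\<lambda>i. apply_bcontfun (f i) (x i))"
  using assms unfolding continuous_on_def by (auto intro: tendsto_apply_bcontfun)

lemma segment_value_measurable:
  "(\<lambda>e. apply_bcontfun (snd (snd e)) u) \<in> borel_measurable (segment_space T)"
  by (rule measurable_restrict_space1, rule borel_measurable_continuous_onI) (intro continuous_intros)

lemma segment_end_measurable: "(\<lambda>e. fst (snd e)) \<in> borel_measurable (segment_space T)"
  by (rule measurable_restrict_space1, rule borel_measurable_continuous_onI) (intro continuous_intros)

lemma end_value_measurable: "end_value \<in> borel_measurable (segment_space T)"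
  unfolding end_value_def
  by (rule measurable_restrict_space1, rule borel_measurable_continuous_onI) (intro continuous_intros)

lemma potential_measurable:
  assumes "B k \<in> sets borel"
  shows "potential B k \<in> borel_measurable (segment_space T \<Otimes>\<^sub>M L)"
proof -
  have "(\<lambda>z. end_value (fst z)) \<in> borel_measurable (segment_space T \<Otimes>\<^sub>M L)"
    by (rule measurable_compose[OF measurable_fst end_value_measurable])
  then show ?thesis
    unfolding potential_def using assms by measurable
qed

lemma apply_embed_segment:
  fixes y :: "real \<Rightarrow> real^'d::finite"
  assumes "s \<le> t" "continuous_on {s..t} y"
  shows "apply_bcontfun (snd (snd (embed_segment s t y))) u = y (max s (min t u))"
proof -
  have cont: "continuous_on UNIV (\<lambda>u. y (max s (min t u)))"
    by (rule continuous_on_compose2[OF assms(2)]) (use assms(1) in \<open>auto intro!: continuous_intros\<close>)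
  have "bounded (y ` {s..t})"
    by (rule compact_imp_bounded[OF compact_continuous_image[OF assms(2)]]) simp
  then have "bounded (range (\<lambda>u. y (max s (min t u))))"
    by (rule bounded_subset) (use assms(1) in auto)
  then show ?thesis
    using cont by (simp add: embed_segment_def Bcontfun_inverse bcontfun_def)
qed

lemma level_time_bounds:
  assumes "0 \<le> T"
  shows "0 \<le> level_time T X B k \<omega>" "level_time T X B k \<omega> \<le> T"
proof -
  have "enn2real (min (hitting_time X (B k) \<omega>) (ennreal T)) \<le> enn2real (ennreal T)"
    by (rule enn2real_mono) auto
  then show "level_time T X B k \<omega> \<le> T" using assms by (simp add: level_time_def)
qed (simp add: level_time_def)

lemma level_time_mono:
  assumes "B (Suc k) \<subseteq> B k"
  shows "level_time T X B k \<omega> \<le> level_time T X B (Suc k) \<omega>"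
proof -
  have "hitting_time X (B k) \<omega> \<le> hitting_time X (B (Suc k)) \<omega>"
    unfolding hitting_time_def by (rule INF_superset_mono) (use assms in auto)
  then show ?thesis
    unfolding level_time_def by (intro enn2real_mono min.mono) (auto simp: min_less_iff_disj)
qed

lemma level_time_UNIV:
  assumes "B k = UNIV"
  shows "level_time T X B k \<omega> = 0"
proof -
  have "hitting_time X (B k) \<omega> \<le> ennreal 0"
    unfolding hitting_time_def by (rule INF_lower) (simp add: assms)
  then show ?thesis by (simp add: level_time_def)
qed

lemma level_time_eq_segment_end:
  "level_time T X B k \<omega> = fst (snd (level_segment T X B k \<omega>))"
  by (simp add: level_segment_def embed_segment_def)

text \<open>The stopped path is the sum of the increments along the segments: the extension of the segment
  from $S_{k-1}$ to $S_k$, evaluated at $u$ minus at $0$, is $X(u\wedge S_k)-X(u\wedge S_{k-1})$.\<close>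

lemma stopped_path_measurable:
  assumes paths: "\<And>\<omega>. \<omega> \<in> space F \<Longrightarrow> continuous_on {0..} (\<lambda>t. X t \<omega>)"
    and "0 \<le> T" "B 0 = UNIV" and nested: "\<And>j. j < k \<Longrightarrow> B (Suc j) \<subseteq> B j"
    and segments: "\<And>j. j \<le> k \<Longrightarrow> level_segment T X B j \<in> F \<rightarrow>\<^sub>M segment_space T"
    and "0 \<le> u"
  shows "(\<lambda>\<omega>. X (min (level_time T X B k \<omega>) u) \<omega>) \<in> borel_measurable F"
  using nested segments
proof (induction k)
  let ?ext = "\<lambda>j v \<omega>. apply_bcontfun (snd (snd (level_segment T X B j \<omega>))) v"
  have ext_measurable: "?ext j v \<in> borel_measurable F"
    if "level_segment T X B j \<in> F \<rightarrow>\<^sub>M segment_space T" for j v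
    by (rule measurable_compose[OF that segment_value_measurable])
  have S: "0 \<le> level_time T X B j \<omega>" for j \<omega> by (rule level_time_bounds(1)[OF \<open>0 \<le> T\<close>])
  have sub: "continuous_on {s..t} (\<lambda>t. X t \<omega>)" if "\<omega> \<in> space F" "0 \<le> s" for s t \<omega>
    using continuous_on_subset[OF paths[OF that(1)]] that by auto
  {
    case 0
    have "X (min (level_time T X B 0 \<omega>) u) \<omega> = ?ext 0 u \<omega>" if "\<omega> \<in> space F" for \<omega>
      using sub[OF that, of 0 0] \<open>0 \<le> u\<close>
      by (simp add: level_segment_def level_time_UNIV[of B 0, OF \<open>B 0 = UNIV\<close>] apply_embed_segment)
    then show ?case
      using ext_measurable[OF 0(2)[of 0]] by (simp cong: measurable_cong)
  next
    case (Suc k)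
    have IH: "(\<lambda>\<omega>. X (min (level_time T X B k \<omega>) u) \<omega>) \<in> borel_measurable F"
      using Suc by auto
    have "X (min (level_time T X B (Suc k) \<omega>) u) \<omega>
        = X (min (level_time T X B k \<omega>) u) \<omega> + (?ext (Suc k) u \<omega> - ?ext (Suc k) 0 \<omega>)"
      if "\<omega> \<in> space F" for \<omega>
    proof -
      have le: "level_time T X B k \<omega> \<le> level_time T X B (Suc k) \<omega>"
        using Suc.prems by (auto intro: level_time_mono)
      have "?ext (Suc k) v \<omega> = X (max (level_time T X B k \<omega>) (min (level_time T X B (Suc k) \<omega>) v)) \<omega>" for v
        using apply_embed_segment[OF le sub[OF that S]] by (simp add: level_segment_def)
      moreover have "max (level_time T X B k \<omega>) (min (level_time T X B (Suc k) \<omega>) 0) = level_time T X B k \<omega>"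
        using S[of k \<omega>] by simp
      ultimately show ?thesis
        using le by (cases "u \<le> level_time T X B k \<omega>") (simp_all add: max_def min_def)
    qed
    moreover have "(\<lambda>\<omega>. X (min (level_time T X B k \<omega>) u) \<omega> + (?ext (Suc k) u \<omega> - ?ext (Suc k) 0 \<omega>))
        \<in> borel_measurable F"
      using IH ext_measurable[OF Suc.prems(2)[of "Suc k"]] by (intro borel_measurable_add borel_measurable_diff) auto
    ultimately show ?case by (simp cong: measurable_cong)
  }
qed

section \<open>The filter at a level time\<close>

text \<open>On the event $t\le S$, observing $X$ up to time $t$ requires no more than the path
  stopped at $S$.\<close>

lemma observed_before_stop:
  fixes X :: "real \<Rightarrow> 'w \<Rightarrow> real^'d" and c :: "'w \<Rightarrow> real"
  assumes F: "space F = space M" and S: "S \<in> borel_measurable F"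
    and stopped: "\<And>u. 0 \<le> u \<Longrightarrow> (\<lambda>\<omega>. X (min (S \<omega>) u) \<omega>) \<in> borel_measurable F"
    and c: "c \<in> borel_measurable (nat_filtration M borel X (ennreal t))" and "0 \<le> t"
  shows "(\<lambda>\<omega>. if t \<le> S \<omega> then c \<omega> else 0) \<in> borel_measurable F"
proof -
  have P: "{\<omega> \<in> space F. t \<le> S \<omega>} \<in> sets F" using S by measurable
  let ?F = "restrict_space F {\<omega>. t \<le> S \<omega>}"
  have "(\<lambda>\<omega>. \<omega>) \<in> ?F \<rightarrow>\<^sub>M nat_filtration M borel X (ennreal t)"
    unfolding nat_filtration_def gen_algebra_def
  proof (rule measurable_measure_of)
    fix y assume "y \<in> {X u -` A \<inter> space M | u A. u \<in> {u. 0 \<le> u \<and> ennreal u \<le> ennreal t} \<and> A \<in> sets borel}"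
    then obtain u A where y: "y = X u -` A \<inter> space M" and u: "0 \<le> u" "u \<le> t" and A: "A \<in> sets borel"
      using \<open>0 \<le> t\<close> by auto
    have min: "min (S \<omega>) u = u" if "t \<le> S \<omega>" for \<omega> using that u by simp
    have "(\<lambda>\<omega>. X (min (S \<omega>) u) \<omega>) -` A \<inter> space ?F \<in> sets ?F"
      by (rule measurable_sets[OF measurable_restrict_space1[OF stopped[OF u(1)]] A])
    also have "(\<lambda>\<omega>. X (min (S \<omega>) u) \<omega>) -` A \<inter> space ?F = (\<lambda>\<omega>. \<omega>) -` y \<inter> space ?F"
      using F by (auto simp: y space_restrict_space min)
    finally show "(\<lambda>\<omega>. \<omega>) -` y \<inter> space ?F \<in> sets ?F" .
  qed (use F in \<open>auto simp: space_restrict_space\<close>)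
  from measurable_compose[OF this c] show ?thesis
    by (simp add: measurable_If_restrict_space_iff[OF P])
qed

lemma borel_measurable_vec_lambda:
  fixes f :: "'m::finite \<Rightarrow> 'w \<Rightarrow> real"
  assumes "\<And>i. f i \<in> borel_measurable F"
  shows "(\<lambda>\<omega>. \<chi> i. f i \<omega>) \<in> borel_measurable F"
  unfolding borel_measurable_euclidean_space[where 'c = "real^'m"]
  using assms by (auto simp: Basis_vec_def inner_axis)

lemma prob_vectors_borel: "(prob_vectors :: (real^'m::finite) set) \<in> sets borel"
  unfolding prob_vectors_def
  by (intro borel_closed closed_Collect_conj closed_Collect_all closed_Collect_le closed_Collect_eq
      continuous_intros)

lemma axis_prob_vector: "axis i 1 \<in> prob_vectors"
  by (auto simp: prob_vectors_def axis_def)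

text \<open>At a fixed time the filter is almost surely a function of the path up to that time. To pass to a
  random time, $S$ is rounded down to a grid: only countably many null sets occur, and a grid
  time below $S$ uses only the stopped path. The continuity of $\pi$ then
  gives the value at $S$. Rounding up would involve the path just after $S$.\<close>

lemma filter_at_stop:
  fixes X :: "real \<Rightarrow> 'w \<Rightarrow> real^'d" and \<theta> :: "real \<Rightarrow> 'w \<Rightarrow> 'm::finite"
  assumes filter: "wonham_filter M X \<theta> \<pi>"
    and F: "space F = space M" and S: "S \<in> borel_measurable F" and S0: "\<And>\<omega>. 0 \<le> S \<omega>"
    and stopped: "\<And>u. 0 \<le> u \<Longrightarrow> (\<lambda>\<omega>. X (min (S \<omega>) u) \<omega>) \<in> borel_measurable F"
  shows "\<exists>Y \<in> F \<rightarrow>\<^sub>M prob_vector_space. AE \<omega> in M. \<pi> (S \<omega>) \<omega> = Y \<omega>"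
proof -
  define c where "c t i = real_cond_exp M (nat_filtration M borel X (ennreal t)) (indicator {\<omega>'. \<theta> t \<omega>' = i})" for t i
  define grid where "grid q j = real j / real (Suc q)" for q j :: nat
  define J where "J q \<omega> = nat \<lfloor>S \<omega> * real (Suc q)\<rfloor>" for q \<omega>
  \<comment> \<open>The condition always holds; it makes each fixed grid value measurable in the stopped path.\<close>
  define Y0 where "Y0 q i \<omega> = (if grid q (J q \<omega>) \<le> S \<omega> then c (grid q (J q \<omega>)) i \<omega> else 0)" for q i \<omega>
  define V where "V \<omega> = (\<chi> i. lim (\<lambda>q. Y0 q i \<omega>))" for \<omega>
  \<comment> \<open>The limit may fail to be a probability vector on a null set; any vertex of the simplex serves there.\<close>
  define Y where "Y \<omega> = (if V \<omega> \<in> prob_vectors then V \<omega> else axis undefined 1)" for \<omega>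
  have Y0: "Y0 q i \<in> borel_measurable F" for q i
    unfolding Y0_def
  proof (rule measurable_compose_countable[where g = "J q"])
    show "J q \<in> F \<rightarrow>\<^sub>M count_space UNIV"
      unfolding J_def using S by measurable
    show "(\<lambda>\<omega>. if grid q j \<le> S \<omega> then c (grid q j) i \<omega> else 0) \<in> borel_measurable F" for j
      by (rule observed_before_stop[where M = M and X = X]) (auto simp: c_def F S stopped grid_def)
  qed
  have V: "V \<in> borel_measurable F"
    unfolding V_def using Y0 by (intro borel_measurable_vec_lambda borel_measurable_lim_metric)
  have YF: "Y \<in> F \<rightarrow>\<^sub>M prob_vector_space"
  proof (rule measurable_restrict_space2)
    have "{\<omega> \<in> space F. V \<omega> \<in> prob_vectors} \<in> sets F"
      using V prob_vectors_borel by measurable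
    then show "Y \<in> borel_measurable F"
      unfolding Y_def by (intro measurable_If V) auto
  qed (auto simp: Y_def axis_prob_vector)
  have "AE \<omega> in M. \<forall>q j i. \<pi> (grid q j) \<omega> $ i = c (grid q j) i \<omega>"
    using filter by (auto simp: AE_all_countable wonham_filter_def c_def grid_def)
  then have "AE \<omega> in M. \<pi> (S \<omega>) \<omega> = Y \<omega>"
  proof (rule AE_mp, intro AE_I2 impI)
    fix \<omega> assume \<omega>: "\<omega> \<in> space M" and eq: "\<forall>q j i. \<pi> (grid q j) \<omega> $ i = c (grid q j) i \<omega>"
    have below: "grid q (J q \<omega>) \<le> S \<omega>" and above: "S \<omega> - 1 / real (Suc q) \<le> grid q (J q \<omega>)" for q
    proof -
      have J: "real (J q \<omega>) = of_int \<lfloor>S \<omega> * real (Suc q)\<rfloor>"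
        using S0[of \<omega>] by (simp add: J_def)
      have "real (J q \<omega>) \<le> S \<omega> * real (Suc q)"
        unfolding J by linarith
      then show "grid q (J q \<omega>) \<le> S \<omega>"
        by (simp add: grid_def pos_divide_le_eq)
      have "S \<omega> * real (Suc q) - 1 \<le> real (J q \<omega>)"
        unfolding J by linarith
      then have "(S \<omega> * real (Suc q) - 1) / real (Suc q) \<le> grid q (J q \<omega>)"
        unfolding grid_def by (rule divide_right_mono) simp
      then show "S \<omega> - 1 / real (Suc q) \<le> grid q (J q \<omega>)"
        by (simp add: diff_divide_distrib)
    qed
    have "(\<lambda>q. S \<omega> - 1 / real (Suc q)) \<longlonglongrightarrow> S \<omega> - 0"
      by (intro tendsto_diff tendsto_const) (use LIMSEQ_inverse_real_of_nat in \<open>simp add: inverse_eq_divide\<close>)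
    then have lower: "(\<lambda>q. S \<omega> - 1 / real (Suc q)) \<longlonglongrightarrow> S \<omega>" by simp
    have lim: "(\<lambda>q. grid q (J q \<omega>)) \<longlonglongrightarrow> S \<omega>"
      by (rule tendsto_sandwich[OF _ _ lower tendsto_const]; rule always_eventually, rule allI)
         (fact above below)+
    have "continuous_on {0..} (\<lambda>t. \<pi> t \<omega>)" using filter \<omega> by (auto simp: wonham_filter_def)
    then have "(\<lambda>q. \<pi> (grid q (J q \<omega>)) \<omega>) \<longlonglongrightarrow> \<pi> (S \<omega>) \<omega>"
      by (rule continuous_on_tendsto_compose[OF _ lim]) (auto simp: S0 grid_def)
    from tendsto_vec_nth[OF this]
    have "(\<lambda>q. Y0 q i \<omega>) \<longlonglongrightarrow> \<pi> (S \<omega>) \<omega> $ i" for i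
      using eq below by (simp add: Y0_def)
    then have "V \<omega> = \<pi> (S \<omega>) \<omega>"
      by (simp add: V_def vec_eq_iff limI)
    moreover have "\<pi> (S \<omega>) \<omega> \<in> prob_vectors"
    proof -
      have "\<pi> (S \<omega>) \<in> M \<rightarrow>\<^sub>M prob_vector_space" using filter S0 by (simp add: wonham_filter_def)
      from measurable_space[OF this \<omega>] show ?thesis by (simp add: space_restrict_space)
    qed
    ultimately show "\<pi> (S \<omega>) \<omega> = Y \<omega>" by (simp add: Y_def)
  qed
  with YF show ?thesis by blast
qed

theorem theorem5p3:
  fixes M :: "'w measure"
    and X W W' :: "real \<Rightarrow> 'w \<Rightarrow> real^'d"
    and \<theta> :: "real \<Rightarrow> 'w \<Rightarrow> 'm::finite"
    and \<pi> :: "real \<Rightarrow> 'w \<Rightarrow> real^'m"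
    and G G' :: "real \<Rightarrow> 'w measure"
    and P :: "real \<Rightarrow> (real^'d) \<times> 'm \<Rightarrow> ((real^'d) \<times> 'm) measure"
    and Q :: "real \<Rightarrow> (real^'d) \<times> (real^'m) \<Rightarrow> ((real^'d) \<times> (real^'m)) measure"
    and b :: "real^'d \<Rightarrow> real^'m^'d"
    and \<Lambda> :: "real^'d \<Rightarrow> real^'m^'m"
    and \<eta> :: "((real^'d) \<times> 'm) measure"
    and T :: real and n :: nat
    and B :: "nat \<Rightarrow> (real^'d) set"
    and K :: "nat \<Rightarrow> 'd segment \<times> 'm \<Rightarrow> ('d segment \<times> 'm) measure"
    and K' :: "nat \<Rightarrow> 'd segment \<times> (real^'m) \<Rightarrow> ('d segment \<times> (real^'m)) measure"
    and R :: "nat \<Rightarrow> 'd segment \<times> 'm \<Rightarrow> real"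
    and R' :: "nat \<Rightarrow> 'd segment \<times> (real^'m) \<Rightarrow> real"
  assumes "prob_space M"
    and "switching_diffusion M G W P b \<Lambda> \<eta> X \<theta>"
    and "wonham_filter M X \<theta> \<pi>"
    and "wonham_diffusion M G' W' Q b \<Lambda> \<eta> X \<pi>"
    and "0 < T"
    and "B 0 = UNIV"
    and "\<And>k. k < n \<Longrightarrow> B (Suc k) \<subseteq> B k"
    and "\<And>k. k \<le> n \<Longrightarrow> B k \<in> sets borel"
    and "\<And>k. k \<le> n \<Longrightarrow> stopping_time (nat_filtration M borel X) (hitting_time X (B k))"
    and "\<And>k. k \<le> n \<Longrightarrow> AE \<omega> in M.
           indicator {\<omega>'. hitting_time X (B k) \<omega>' \<le> ennreal T} \<omega> =
           (\<Prod>p\<le>k. potential B p (level_chain T X B \<theta> p \<omega>))"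
    and "markov_chain M (segment_mode_space T) n (level_chain T X B \<theta>) K"
    and "markov_chain M (segment_filter_space T) n (level_chain T X B \<pi>) K'"
    and "measure M {\<omega>\<in>space M. hitting_time X (B n) \<omega> \<le> ennreal T} > 0"
    and "survival_functions M (segment_mode_space T) n (potential B) (level_chain T X B \<theta>) R"
    and "survival_functions M (segment_filter_space T) n (potential B) (level_chain T X B \<pi>) R'"
  shows "let \<mu> = (\<lambda>k. normalized (feynman_kac M (segment_mode_space T) (potential B) (level_chain T X B \<theta>) k));
             \<mu>' = (\<lambda>k. normalized (feynman_kac M (segment_filter_space T) (potential B) (level_chain T X B \<pi>) k));
             \<eta>' = predicted M (segment_filter_space T) (potential B) (level_chain T X B \<pi>) K';
             p = (\<lambda>k. \<integral>z. potential B k z \<partial>\<eta>' k);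
             V' = (\<Sum>k\<le>n. (\<integral>z. (potential B k z * R' k z)\<^sup>2 \<partial>\<eta>' k)
                          / (\<integral>z. potential B k z * R' k z \<partial>\<eta>' k)\<^sup>2 - 1)
         in V' = variance_formula n p \<mu>' R' \<and> V' \<le> variance_formula n p \<mu> R"
proof -
  note prob = assms(1) and filter = assms(3) and T = assms(5) and B0 = assms(6) and nested = assms(7)
    and borel_levels = assms(8) and survival_event = assms(10) and chain = assms(11) and chain' = assms(12)
    and positive = assms(13) and survival = assms(14) and survival' = assms(15)
  let ?Z = "level_chain T X B \<theta>" and ?Z' = "level_chain T X B \<pi>"
  let ?N = "segment_mode_space T :: ('d segment \<times> 'm) measure"
  let ?N' = "segment_filter_space T :: ('d segment \<times> (real^'m)) measure"
  interpret prob_space M by (rule prob)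
  have paths: "continuous_on {0..} (\<lambda>t. X t \<omega>)" if "\<omega> \<in> space M" for \<omega>
    using assms(2) that unfolding switching_diffusion_def by blast
  have same: "potential B p (?Z' p \<omega>) = potential B p (?Z p \<omega>)" for p \<omega>
    by (simp add: potential_def level_chain_def)
  have binary: "potential B p z \<in> {0, 1}" for p and z :: "'d segment \<times> 'c"
    by (simp add: potential_def indicator_def)
  have Z: "?Z p \<in> M \<rightarrow>\<^sub>M ?N" if "p \<le> n" for p
    using chain that by (simp add: markov_chain_def)
  have g: "potential B p \<in> borel_measurable (segment_space T \<Otimes>\<^sub>M L)" if "p \<le> n" for p L
    using borel_levels[OF that] by (rule potential_measurable)
  have survivors: "0 < (\<integral>\<omega>. (\<Prod>p\<le>n. potential B p (?Z p \<omega>)) \<partial>M)"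
  proof -
    let ?E = "{\<omega> \<in> space M. hitting_time X (B n) \<omega> \<le> ennreal T}"
    \<comment> \<open>A non-measurable set would have measure 0.\<close>
    have E: "?E \<in> sets M"
      using positive by (rule contrapos_pp) (simp add: measure_notin_sets)
    have "measure M ?E = (\<integral>\<omega>. indicator ?E \<omega> \<partial>M)"
      using E by simp
    also have "\<dots> = (\<integral>\<omega>. (\<Prod>p\<le>n. potential B p (?Z p \<omega>)) \<partial>M)"
    proof (rule integral_cong_AE)
      show "(\<lambda>\<omega>. \<Prod>p\<le>n. potential B p (?Z p \<omega>)) \<in> borel_measurable M"
        by (rule borel_measurable_prod, rule measurable_compose[OF Z g]) auto
      show "AE \<omega> in M. indicator ?E \<omega> = (\<Prod>p\<le>n. potential B p (?Z p \<omega>))"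
        using survival_event[OF order_refl] AE_space
        by eventually_elim (simp add: indicator_def)
    qed (use E in simp)
    finally show ?thesis using positive by simp
  qed
  interpret fine: feynman_kac_chain M ?N n ?Z K "potential B" R
    by unfold_locales (fact chain, rule g, assumption, rule binary, fact survival, fact survivors)
  interpret coarse: feynman_kac_chain M ?N' n ?Z' K' "potential B" R'
    by unfold_locales (fact chain', rule g, assumption, rule binary, fact survival', unfold same, fact survivors)
  interpret coarser_chain M ?N ?N' n ?Z ?Z' K K' "potential B" "potential B" R R'
  proof unfold_locales
    fix k assume k: "k \<le> n"
    let ?F = "fine.history (Suc k)"
    have segment: "level_segment T X B j \<in> ?F \<rightarrow>\<^sub>M segment_space T" if "j \<le> k" for j
      using measurable_compose[OF fine.Z_history[of j "Suc k"] measurable_fst] that k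
      by (simp add: level_chain_def)
    have stopped: "(\<lambda>\<omega>. X (min (level_time T X B k \<omega>) u) \<omega>) \<in> borel_measurable ?F" if "0 \<le> u" for u
    proof (rule stopped_path_measurable[OF _ less_imp_le[OF T] B0 _ segment that])
      show "continuous_on {0..} (\<lambda>t. X t \<omega>)" if "\<omega> \<in> space ?F" for \<omega>
        using paths that by simp
      show "B (Suc j) \<subseteq> B j" if "j < k" for j
        using that k by (intro nested) simp
    qed
    have "(\<lambda>\<omega>. level_time T X B k \<omega>) \<in> borel_measurable ?F"
      unfolding level_time_eq_segment_end by (rule measurable_compose[OF segment segment_end_measurable]) simp
    from filter_at_stop[OF filter fine.space_history this level_time_bounds(1)[OF less_imp_le[OF T]] stopped]
    obtain Y where Y: "Y \<in> ?F \<rightarrow>\<^sub>M prob_vector_space"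
      and Y_eq: "AE \<omega> in M. \<pi> (level_time T X B k \<omega>) \<omega> = Y \<omega>"
      by blast
    show "\<exists>Y \<in> ?F \<rightarrow>\<^sub>M ?N'. AE \<omega> in M. ?Z' k \<omega> = Y \<omega>"
    proof (rule bexI)
      show "(\<lambda>\<omega>. (level_segment T X B k \<omega>, Y \<omega>)) \<in> ?F \<rightarrow>\<^sub>M ?N'"
        using segment[OF order_refl] Y by (rule measurable_Pair)
      show "AE \<omega> in M. ?Z' k \<omega> = (level_segment T X B k \<omega>, Y \<omega>)"
        using Y_eq by eventually_elim (simp add: level_chain_def)
    qed
  qed (rule same)
  show ?thesis
    unfolding Let_def
  proof
    let ?p = "\<lambda>k. \<integral>z. potential B k z \<partial>predicted M ?N' (potential B) ?Z' K' k"
    have p: "?p k = coarse.mass (Suc k) / coarse.mass k" if "k \<le> n" for k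
      by (rule coarse.predicted_survival(1)[OF that])
    show V': "(\<Sum>k\<le>n. (\<integral>z. (potential B k z * R' k z)\<^sup>2 \<partial>predicted M ?N' (potential B) ?Z' K' k)
          / (\<integral>z. potential B k z * R' k z \<partial>predicted M ?N' (potential B) ?Z' K' k)\<^sup>2 - 1)
        = variance_formula n ?p (\<lambda>k. normalized (feynman_kac M ?N' (potential B) ?Z' k)) R'"
      using coarse.variance_formula_moments[of ?p, OF p] coarse.predicted_survival(2) by simp
    show "(\<Sum>k\<le>n. (\<integral>z. (potential B k z * R' k z)\<^sup>2 \<partial>predicted M ?N' (potential B) ?Z' K' k)
          / (\<integral>z. potential B k z * R' k z \<partial>predicted M ?N' (potential B) ?Z' K' k)\<^sup>2 - 1)
        \<le> variance_formula n ?p (\<lambda>k. normalized (feynman_kac M ?N (potential B) ?Z k)) R"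
      unfolding V' by (rule variance_le[of ?p, OF p])
  qed
qed

end
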